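(* Let $\lambda$ be a cardinal, let $r\in\omega$ be a natural number, and let $S$ be a nowhere stationary set of cardinals. Then every hypergraph $\mathcal E\subseteq [\lambda]^{S}$ possessing property $C(2,r)$ has a minimal vertex cover.
   Context: A hypergraph is identified with a family $\mathcal E$ of non-empty sets (its edges); its vertex set is $\bigcup\mathcal E$. For a set $A$ and a set $S$ of cardinals, $[A]^{S}=\{B\subseteq A: |B|\in S\}$. A hypergraph $\mathcal E$ possesses property $C(k,\rho)$ iff $|\bigcap\mathcal E'|<\rho$ for every set $\mathcal E'\subseteq\mathcal E$ of exactly $k$ distinct edges. A set $Y\subseteq\bigcup\mathcal E$ is a vertex cover of $\mathcal E$ iff $Y\cap E\neq\emptyset$ for every $E\in\mathcal E$; it is a minimal vertex cover iff no proper subset of $Y$ is a vertex cover of $\mathcal E$. A set $S$ of cardinals is nowhere stationary iff $S\cap\alpha$ is not a stationary subset of $\alpha$ for any ordinal $\alpha$ with $\mathrm{cf}(\alpha)>\omega$. *)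

theory Defs
  imports Main
begin

unbundle cardinal_syntax

section \<open>Ordinals and stationary sets\<close>

text \<open>
  Ordinals are represented by well-orders, up to \<open>=o\<close>; cardinals by relations satisfying
  \<^const>\<open>Card_order\<close>; the natural number \<open>n\<close> by \<^term>\<open>natLeq_on n\<close>.
  The elements of an ordinal \<open>\<alpha>\<close> are the elements of \<^term>\<open>Field \<alpha>\<close>, where \<open>x\<close> stands for the
  ordinal \<open>seg \<alpha> x\<close>, the order type of its predecessors.
\<close>

definition seg :: "'a rel \<Rightarrow> 'a \<Rightarrow> 'a rel" where
  "seg \<alpha> x = Restr \<alpha> (underS \<alpha> x)"

text \<open>
  Since the comparison is not strict, a subset of a successor ordinal is unbounded
  iff it contains the largest element. Thus successors have cofinality \<open>1\<close> below (the strict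
  \<^const>\<open>cofinal\<close> has no instances there).
\<close>

definition unbounded_in :: "'a rel \<Rightarrow> 'a set \<Rightarrow> bool" where
  "unbounded_in \<alpha> C \<longleftrightarrow> C \<subseteq> Field \<alpha> \<and> (\<forall>x\<in>Field \<alpha>. \<exists>y\<in>C. (x, y) \<in> \<alpha>)"

definition cf :: "'a rel \<Rightarrow> 'a rel" where
  "cf \<alpha> = |SOME K. unbounded_in \<alpha> K \<and> (\<forall>K'. unbounded_in \<alpha> K' \<longrightarrow> |K| \<le>o |K'| )|"

text \<open>
  The premises say that \<open>x\<close> is a limit ordinal and that \<open>C\<close> is unbounded in it: the strict
  \<^const>\<open>cofinal\<close> excludes successors, and the first premise excludes \<open>0\<close>.
\<close>

definition closed_in_ordinal :: "'a rel \<Rightarrow> 'a set \<Rightarrow> bool" where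
  "closed_in_ordinal \<alpha> C \<longleftrightarrow> C \<subseteq> Field \<alpha> \<and>
     (\<forall>x\<in>Field \<alpha>. underS \<alpha> x \<noteq> {} \<and> cofinal (C \<inter> underS \<alpha> x) (seg \<alpha> x) \<longrightarrow> x \<in> C)"

definition club_in :: "'a rel \<Rightarrow> 'a set \<Rightarrow> bool" where
  "club_in \<alpha> C \<longleftrightarrow> closed_in_ordinal \<alpha> C \<and> unbounded_in \<alpha> C"

definition stationary_in :: "'a rel \<Rightarrow> 'a set \<Rightarrow> bool" where
  "stationary_in \<alpha> T \<longleftrightarrow> T \<subseteq> Field \<alpha> \<and> (\<forall>C. club_in \<alpha> C \<longrightarrow> T \<inter> C \<noteq> {})"

text \<open>The set \<open>S \<inter> \<alpha>\<close>, for a set \<open>S\<close> of ordinals and an ordinal \<open>\<alpha>\<close>.\<close>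

definition ordinals_below :: "'b rel set \<Rightarrow> 'a rel \<Rightarrow> 'a set" where
  "ordinals_below S \<alpha> = {x \<in> Field \<alpha>. \<exists>\<kappa>\<in>S. seg \<alpha> x =o \<kappa>}"

definition cardinals :: "'b rel set \<Rightarrow> bool" where
  "cardinals S \<longleftrightarrow> (\<forall>\<kappa>\<in>S. Card_order \<kappa>)"

text \<open>
  It suffices to let \<open>\<alpha>\<close> range over the well-orders on subsets of the type \<open>'b\<close> of \<open>S\<close>, that is,
  over all ordinals below \<open>|UNIV :: 'b set|\<^sup>+\<close>. For larger \<open>\<alpha>\<close> the set \<open>S \<inter> \<alpha>\<close> is
  bounded in \<open>\<alpha>\<close> (members of \<open>S\<close> are at most \<open>|UNIV :: 'b set|\<close>), so it is not stationary
  in \<open>\<alpha>\<close>. Every set of cardinals can be represented on a sufficiently large type \<open>'b\<close>.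
\<close>

definition nowhere_stationary :: "'b rel set \<Rightarrow> bool" where
  "nowhere_stationary S \<longleftrightarrow>
     (\<forall>\<alpha> :: 'b rel. Well_order \<alpha> \<and> natLeq <o cf \<alpha> \<longrightarrow> \<not> stationary_in \<alpha> (ordinals_below S \<alpha>))"

lemma unbounded_in_Field: "Well_order \<alpha> \<Longrightarrow> unbounded_in \<alpha> (Field \<alpha>)"
  unfolding unbounded_in_def order_on_defs refl_on_def by blast

lemma cf_witness:
  assumes "Well_order \<alpha>"
  obtains K where "unbounded_in \<alpha> K" "\<And>K'. unbounded_in \<alpha> K' \<Longrightarrow> |K| \<le>o |K'|" "cf \<alpha> = |K|"
proof -
  let ?P = "\<lambda>K. unbounded_in \<alpha> K \<and> (\<forall>K'. unbounded_in \<alpha> K' \<longrightarrow> |K| \<le>o |K'| )"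
  have "card_of ` {K. unbounded_in \<alpha> K} \<noteq> {}"
    using unbounded_in_Field[OF assms] by blast
  moreover have "\<forall>r\<in>card_of ` {K. unbounded_in \<alpha> K}. Card_order r"
    using card_of_Card_order by blast
  ultimately have "\<exists>K. ?P K"
    using exists_minim_Card_order[of "card_of ` {K. unbounded_in \<alpha> K}"] by blast
  then have "?P (SOME K. ?P K)" by (rule someI_ex)
  then show thesis using that[of "SOME K. ?P K"] unfolding cf_def by blast
qed

lemma natLeq_less_cf_iff:
  assumes "Well_order \<alpha>"
  shows "natLeq <o cf \<alpha> \<longleftrightarrow> (\<forall>K. unbounded_in \<alpha> K \<longrightarrow> natLeq <o |K| )"
proof -
  obtain K where "unbounded_in \<alpha> K" "\<And>K'. unbounded_in \<alpha> K' \<Longrightarrow> |K| \<le>o |K'|" "cf \<alpha> = |K|"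
    using cf_witness[OF assms] by blast
  then show ?thesis using ordLess_ordLeq_trans[of natLeq "|K|"] by auto
qed

section \<open>Hypergraphs\<close>

text \<open>\<open>[A]\<^sup>S\<close>, the set of all subsets of \<open>A\<close> whose cardinality belongs to \<open>S\<close>.\<close>

definition subsets_of_card :: "'a set \<Rightarrow> 'b rel set \<Rightarrow> 'a set set" where
  "subsets_of_card A S = {B. B \<subseteq> A \<and> (\<exists>\<kappa>\<in>S. |B| =o \<kappa>)}"

definition hypergraph :: "'a set set \<Rightarrow> bool" where
  "hypergraph \<E> \<longleftrightarrow> {} \<notin> \<E>"

definition property_C :: "'k rel \<Rightarrow> 'r rel \<Rightarrow> 'a set set \<Rightarrow> bool" where
  "property_C k \<rho> \<E> \<longleftrightarrow> (\<forall>\<E>' \<subseteq> \<E>. |\<E>'| =o k \<longrightarrow> |\<Inter>\<E>'| <o \<rho>)"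

definition vertex_cover :: "'a set set \<Rightarrow> 'a set \<Rightarrow> bool" where
  "vertex_cover \<E> Y \<longleftrightarrow> Y \<subseteq> \<Union>\<E> \<and> (\<forall>E\<in>\<E>. Y \<inter> E \<noteq> {})"

definition minimal_vertex_cover :: "'a set set \<Rightarrow> 'a set \<Rightarrow> bool" where
  "minimal_vertex_cover \<E> Y \<longleftrightarrow> vertex_cover \<E> Y \<and> (\<forall>Z. Z \<subset> Y \<longrightarrow> \<not> vertex_cover \<E> Z)"

lemma card_of_lessThan_natLeq_on: "|{..<n}| =o natLeq_on n"
proof -
  have "well_order_on {..<n} (natLeq_on n)"
    using natLeq_on_well_order_on[of n] unfolding lessThan_def .
  then show ?thesis
    using finite_well_order_on_ordIso[of "{..<n}"] card_of_well_order_on by blast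
qed

lemma card_of_ordIso_natLeq_on_iff: "|A| =o natLeq_on n \<longleftrightarrow> finite A \<and> card A = n"
proof -
  have "|A| =o natLeq_on n \<longleftrightarrow> |A| =o |{..<n}|"
    using card_of_lessThan_natLeq_on ordIso_symmetric ordIso_transitive by blast
  also have "\<dots> \<longleftrightarrow> (\<exists>f. bij_betw f A {..<n})" by (simp add: card_of_ordIso)
  also have "\<dots> \<longleftrightarrow> finite A \<and> card A = n"
    using bij_betw_finite[of _ A "{..<n}"] bij_betw_same_card[of _ A "{..<n}"]
      finite_same_card_bij[of A "{..<n}"] by auto
  finally show ?thesis .
qed

lemma card_of_ordLess_natLeq_on_iff: "|A| <o natLeq_on n \<longleftrightarrow> finite A \<and> card A < n"
proof -
  have "|A| <o natLeq_on n \<longleftrightarrow> |A| <o |{..<n}|"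
    using card_of_lessThan_natLeq_on ordIso_symmetric ordLess_ordIso_trans by blast
  also have "\<dots> \<longleftrightarrow> \<not> |{..<n}| \<le>o |A|"
    using not_ordLeq_iff_ordLess[OF card_of_Well_order card_of_Well_order] by blast
  also have "\<dots> \<longleftrightarrow> \<not> (\<exists>f. inj_on f {..<n} \<and> f ` {..<n} \<subseteq> A)"
    by (simp add: card_of_ordLeq)
  also have "\<dots> \<longleftrightarrow> finite A \<and> card A < n"
  proof (cases "finite A")
    case True
    then show ?thesis
      using inj_on_iff_card_le[of "{..<n}" A] by auto
  next
    case False
    then obtain B where "B \<subseteq> A" "finite B" "card B = n"
      using infinite_arbitrarily_large by blast
    moreover from this obtain f where "inj_on f {..<n}" "f ` {..<n} \<subseteq> B"
      using inj_on_iff_card_le[of "{..<n}" B] by auto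
    ultimately show ?thesis
      using False by blast
  qed
  finally show ?thesis .
qed

lemma property_C_2_iff:
  "property_C (natLeq_on 2) (natLeq_on r) \<E> \<longleftrightarrow>
     (\<forall>A\<in>\<E>. \<forall>B\<in>\<E>. A \<noteq> B \<longrightarrow> finite (A \<inter> B) \<and> card (A \<inter> B) < r)"
proof
  assume C: "property_C (natLeq_on 2) (natLeq_on r) \<E>"
  show "\<forall>A\<in>\<E>. \<forall>B\<in>\<E>. A \<noteq> B \<longrightarrow> finite (A \<inter> B) \<and> card (A \<inter> B) < r"
  proof (intro ballI impI)
    fix A B assume "A \<in> \<E>" "B \<in> \<E>" "A \<noteq> B"
    then have "{A, B} \<subseteq> \<E>" "|{A, B}| =o natLeq_on 2"
      by (auto simp: card_of_ordIso_natLeq_on_iff)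
    then have "|\<Inter>{A, B}| <o natLeq_on r" using C unfolding property_C_def by blast
    then show "finite (A \<inter> B) \<and> card (A \<inter> B) < r"
      unfolding card_of_ordLess_natLeq_on_iff by simp
  qed
next
  assume *: "\<forall>A\<in>\<E>. \<forall>B\<in>\<E>. A \<noteq> B \<longrightarrow> finite (A \<inter> B) \<and> card (A \<inter> B) < r"
  show "property_C (natLeq_on 2) (natLeq_on r) \<E>"
    unfolding property_C_def card_of_ordIso_natLeq_on_iff card_of_ordLess_natLeq_on_iff
  proof (intro allI impI)
    fix X assume "X \<subseteq> \<E>" "finite X \<and> card X = 2"
    then obtain A B where "X = {A, B}" "A \<noteq> B" by (auto simp: card_2_iff)
    with * \<open>X \<subseteq> \<E>\<close> show "finite (\<Inter>X) \<and> card (\<Inter>X) < r" by simp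
  qed
qed

end

theory Submission
  imports Defs "HOL-Library.Countable_Set"
begin

text \<open>
  A vertex cover is minimal if every vertex \<open>y\<close> of it has a private edge, one that meets the cover
  in \<open>y\<close> only. Covers are built by transfinite recursion: a new vertex has to avoid the private
  edges already in use, and its private edge has to avoid the vertices already chosen.

  The recursion goes by induction on the cardinality \<open>\<lambda>\<close> of the vertex set. Edges smaller than
  \<open>\<lambda>\<close> are handled along an increasing chain of vertex sets closed under the edges that contain \<open>r\<close>
  of their points. Since \<open>S\<close> is not stationary below \<open>\<lambda>\<close>, the stages of the chain can be chosen
  such that an edge entering at some stage meets the union of the earlier stages in a set smaller
  than itself. The edges of size \<open>\<lambda>\<close> follow one by one. For them to be still coverable, fewer than
  \<open>\<lambda>\<close> of their points may lie in the private edges used so far. Hence the induction carries a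
  family of ranked sets that the cover tries to hit, those of lower rank first: a set that is never
  hit loses points only at stages at which some set of at most the same rank is hit for the first
  time, and there are few such stages.
\<close>

section \<open>Partial covers with private edges\<close>

text \<open>So it is not enough that a stage leaves an infinite edge some point: the edge has to
  keep its cardinality, which then still lies in \<open>S\<close>. This can fail only where the
  earlier stages climb up to the size of the edge, at an initial ordinal that is a limit of the
  chosen stages; here non-stationarity is used. Edges of full size \<lambda> fit into no stage, and
  for singular \<lambda> it would not help that fewer than \<lambda> stages cost such an edge fewer
  than \<lambda> points each: the total could still be \<lambda>. Therefore the number of lossy
  stages and the loss at each of them are bounded by one and the same cardinal, given by the rank.
  The rank of an edge of full size is an index with fewer than \<lambda> predecessors, so the total
  loss stays below \<lambda>, and regular and singular \<lambda> are treated alike.\<close>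

text \<open>
  A partial cover is represented by the set \<open>M\<close> of pairs of a vertex \<open>y\<close> and its private edge;
  \<open>pts M\<close> is the set of vertices, \<open>cov M\<close> the set of points used up by private edges.
\<close>

definition pts :: "('a \<times> 'a set) set \<Rightarrow> 'a set" where
  "pts M = fst ` M"

definition cov :: "('a \<times> 'a set) set \<Rightarrow> 'a set" where
  "cov M = \<Union>(snd ` M)"

definition private_edges :: "('a \<times> 'a set) set \<Rightarrow> bool" where
  "private_edges M \<longleftrightarrow> (\<forall>(y, E)\<in>M. E \<inter> pts M = {y})"

definition private_cover :: "'a set set \<Rightarrow> ('a \<times> 'a set) set \<Rightarrow> bool" where
  "private_cover \<G> M \<longleftrightarrow> private_edges M \<and> snd ` M \<subseteq> \<G> \<and> (\<forall>E\<in>\<G>. E \<inter> pts M \<noteq> {})"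

definition almost_disjoint :: "nat \<Rightarrow> 'a set set \<Rightarrow> bool" where
  "almost_disjoint r \<G> \<longleftrightarrow> (\<forall>A\<in>\<G>. \<forall>B\<in>\<G>. A \<noteq> B \<longrightarrow> finite (A \<inter> B) \<and> card (A \<inter> B) < r)"

definition traces :: "'a set set \<Rightarrow> 'a set \<Rightarrow> 'a set set" where
  "traces \<F> D = (\<lambda>E. E - D) ` \<F>"

definition sized :: "'b rel set \<Rightarrow> 'a set set \<Rightarrow> bool" where
  "sized S \<G> \<longleftrightarrow> (\<forall>E\<in>\<G>. finite E \<or> (\<exists>\<kappa>\<in>S. |E| =o \<kappa>))"

lemma pts_Un [simp]: "pts (M \<union> N) = pts M \<union> pts N"
  by (simp add: pts_def image_Un)

lemma cov_Un [simp]: "cov (M \<union> N) = cov M \<union> cov N"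
  by (simp add: cov_def)

lemma pts_empty [simp]: "pts {} = {}"
  by (simp add: pts_def)

lemma cov_empty [simp]: "cov {} = {}"
  by (simp add: cov_def)

lemma pts_insert [simp]: "pts (insert (y, E) M) = insert y (pts M)"
  by (simp add: pts_def)

lemma cov_insert [simp]: "cov (insert (y, E) M) = E \<union> cov M"
  by (simp add: cov_def)

lemma pts_UN: "pts (\<Union>x\<in>I. N x) = (\<Union>x\<in>I. pts (N x))"
  by (auto simp: pts_def)

lemma cov_UN: "cov (\<Union>x\<in>I. N x) = (\<Union>x\<in>I. cov (N x))"
  by (auto simp: cov_def)

lemma pts_subset_cov: "private_edges M \<Longrightarrow> pts M \<subseteq> cov M"
  by (force simp: private_edges_def pts_def cov_def)

lemma almost_disjointD:
  "\<lbrakk>almost_disjoint r \<G>; A \<in> \<G>; B \<in> \<G>; A \<noteq> B\<rbrakk> \<Longrightarrow> finite (A \<inter> B) \<and> card (A \<inter> B) < r"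
  by (simp add: almost_disjoint_def)

lemma almost_disjoint_subset: "almost_disjoint r \<G> \<Longrightarrow> \<F> \<subseteq> \<G> \<Longrightarrow> almost_disjoint r \<F>"
  unfolding almost_disjoint_def by (metis subsetD)

lemma almost_disjoint_traces:
  assumes "almost_disjoint r \<F>"
  shows "almost_disjoint r (traces \<F> D)"
  unfolding almost_disjoint_def traces_def
proof (clarify)
  fix E E' assume E: "E \<in> \<F>" "E' \<in> \<F>" "E - D \<noteq> E' - D"
  then have "finite (E \<inter> E') \<and> card (E \<inter> E') < r"
    using almost_disjointD[OF assms, of E E'] by blast
  moreover have "(E - D) \<inter> (E' - D) \<subseteq> E \<inter> E'" by blast
  ultimately have "finite ((E - D) \<inter> (E' - D))" "card ((E - D) \<inter> (E' - D)) \<le> card (E \<inter> E')"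
    "card (E \<inter> E') < r"
    using finite_subset card_mono by blast+
  then show "finite ((E - D) \<inter> (E' - D)) \<and> card ((E - D) \<inter> (E' - D)) < r" by linarith
qed

lemma sized_subset: "sized S \<G> \<Longrightarrow> \<F> \<subseteq> \<G> \<Longrightarrow> sized S \<F>"
  unfolding sized_def by blast

lemma minimal_vertex_cover_if_private_cover:
  assumes "private_cover \<G> M"
  shows "minimal_vertex_cover \<G> (pts M)"
proof -
  have priv: "\<forall>(y, E)\<in>M. E \<inter> pts M = {y}" and sub: "snd ` M \<subseteq> \<G>" and hit: "\<forall>E\<in>\<G>. E \<inter> pts M \<noteq> {}"
    using assms by (auto simp: private_cover_def private_edges_def)
  have "pts M \<subseteq> \<Union>\<G>"
    using pts_subset_cov[of M] Union_mono[OF sub] assms by (auto simp: private_cover_def cov_def)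
  moreover have "\<not> vertex_cover \<G> Z" if Z: "Z \<subset> pts M" for Z
  proof -
    obtain y where y: "y \<in> pts M" "y \<notin> Z" using Z by blast
    then obtain E where E: "(y, E) \<in> M" by (auto simp: pts_def)
    then have "E \<in> snd ` M" by force
    then have "E \<in> \<G>" using sub by blast
    moreover have "E \<inter> pts M = {y}" using priv E by auto
    moreover have "Z \<inter> E \<subseteq> E \<inter> pts M" using Z by blast
    ultimately have "E \<in> \<G>" "Z \<inter> E = {}" using y(2) by auto
    then show ?thesis unfolding vertex_cover_def by blast
  qed
  ultimately show ?thesis
    using hit unfolding minimal_vertex_cover_def vertex_cover_def by blast
qed

text \<open>Several edges may have the same trace, but one edge chosen per trace suffices as private
  edge: the vertices of \<open>M\<close> lie in traces, hence outside \<open>D\<close>, and so meet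
  an edge exactly where they meet its trace.\<close>

lemma lift_traces:
  assumes "private_cover (traces \<F> D) M"
  obtains N where "pts N = pts M" "snd ` N \<subseteq> \<F>" "private_edges N" "cov N - D = cov M" "pts N \<inter> D = {}"
    "\<forall>E\<in>\<F>. E \<inter> pts N \<noteq> {}"
proof -
  define e where "e = inv_into \<F> (\<lambda>E. E - D)"
  define N where "N = (\<lambda>(y, T). (y, e T)) ` M"
  have priv: "\<forall>(y, T)\<in>M. T \<inter> pts M = {y}" and sub: "snd ` M \<subseteq> traces \<F> D"
    and hit: "\<forall>T\<in>traces \<F> D. T \<inter> pts M \<noteq> {}"
    using assms by (auto simp: private_cover_def private_edges_def)
  have e: "e T \<in> \<F> \<and> e T - D = T" if "(y, T) \<in> M" for y T
  proof -
    have "T \<in> (\<lambda>E. E - D) ` \<F>" using that sub by (force simp: traces_def)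
    then show ?thesis
      using f_inv_into_f[of T "\<lambda>E. E - D" \<F>] inv_into_into[of T "\<lambda>E. E - D" \<F>] by (auto simp: e_def)
  qed
  have 1: "pts N = pts M" by (force simp: N_def pts_def)
  have 2: "pts M \<inter> D = {}"
  proof -
    have "pts M \<subseteq> cov M" using assms pts_subset_cov by (auto simp: private_cover_def)
    also have "cov M \<inter> D = {}" using sub by (fastforce simp: cov_def traces_def)
    finally show ?thesis using \<open>pts M \<subseteq> cov M\<close> by blast
  qed
  show thesis
  proof (rule that[of N])
    show "pts N = pts M" by (fact 1)
    show "snd ` N \<subseteq> \<F>" using e by (auto simp: N_def)
    show "pts N \<inter> D = {}" using 1 2 by simp
    have "E \<inter> pts N = {y}" if yE: "(y, E) \<in> N" for y E
    proof -
      obtain T where T: "(y, T) \<in> M" "E = e T" using yE by (auto simp: N_def)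
      have "e T \<inter> pts M = T \<inter> pts M" using e[OF T(1)] 2 by blast
      then show ?thesis using priv T 1 by auto
    qed
    then show "private_edges N" by (auto simp: private_edges_def)
    have "cov N - D = (\<Union>(y,T)\<in>M. e T - D)" by (auto simp: N_def cov_def)
    also have "\<dots> = (\<Union>(y,T)\<in>M. T)" by (rule SUP_cong) (use e in auto)
    also have "\<dots> = cov M" by (auto simp: cov_def)
    finally show "cov N - D = cov M" .
    show "\<forall>E\<in>\<F>. E \<inter> pts N \<noteq> {}" using hit 1 by (fastforce simp: traces_def)
  qed
qed

text \<open>Almost disjointness replaces well-foundedness of inclusion: a member properly inside
  another one equals their intersection and is therefore finite, and below a finite set a member of
  least cardinality is minimal.\<close>

lemma exists_minimal_member:
  assumes "almost_disjoint r \<G>" "E \<in> \<G>"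
  obtains T where "T \<in> \<G>" "T \<subseteq> E" "\<And>T'. T' \<in> \<G> \<Longrightarrow> T' \<subseteq> T \<Longrightarrow> T' = T"
proof (cases "\<exists>T\<in>\<G>. T \<subset> E")
  case False
  then show ?thesis using that[of E] assms(2) by blast
next
  case True
  then obtain T0 where T0: "T0 \<in> \<G>" "T0 \<subset> E" by blast
  have "finite (E \<inter> T0)" using almost_disjointD[OF assms(1,2) T0(1)] T0(2) by blast
  then have "finite T0" using T0(2) by (simp add: Int_absorb1 psubset_imp_subset)
  let ?P = "\<lambda>T. T \<in> \<G> \<and> T \<subseteq> T0"
  obtain T where T: "?P T" "\<forall>T'. ?P T' \<longrightarrow> card T \<le> card T'"
    using ex_has_least_nat[of ?P T0 card] T0(1) by blast
  show ?thesis
  proof (rule that[of T])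
    show "T \<in> \<G>" "T \<subseteq> E" using T T0 by auto
    fix T' assume T': "T' \<in> \<G>" "T' \<subseteq> T"
    then have "card T \<le> card T'" using T by blast
    moreover have "finite T" using T \<open>finite T0\<close> finite_subset by blast
    ultimately show "T' = T" using T'(2) card_seteq by blast
  qed
qed

lemma ordIso_Diff:
  assumes "infinite A" "|A \<inter> D| <o |A|"
  shows "|A - D| =o |A|"
proof (rule ccontr)
  assume "\<not> ?thesis"
  moreover have "|A - D| \<le>o |A|" by (simp add: card_of_mono1)
  ultimately have "|A - D| <o |A|" by (simp add: ordLeq_iff_ordLess_or_ordIso)
  then have "|(A - D) \<union> (A \<inter> D)| <o |A|"
    using card_of_Un_ordLess_infinite[OF assms(1)] assms(2) by blast
  moreover have "(A - D) \<union> (A \<inter> D) = A" by blast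
  ultimately show False by (simp add: ordLess_irreflexive)
qed

lemma finite_ordLess: "finite A \<Longrightarrow> infinite B \<Longrightarrow> |A| <o |B|"
  by (rule finite_ordLess_infinite[OF card_of_Well_order card_of_Well_order]) (simp_all add: Field_card_of)

section \<open>Small losses, ranked sets and solvability\<close>

context wellorder
begin

text \<open>
  Sets of rank \<open>i\<close> may lose a \<open>small i\<close> set of points. All finite sets are small, so that
  \<open>small i\<close> is closed under unions over small index sets also for finite \<open>i\<close>.
\<close>

definition small :: "'a \<Rightarrow> 'c set \<Rightarrow> bool" where
  "small i X \<longleftrightarrow> finite X \<or> |X| \<le>o |{..<i}|"

text \<open>Every injective indexing has this property. The counting form also survives merging two
  families with their own ranks, as happens when the edges of full size join the sets inherited from
  outside.\<close>

definition ranked :: "'a set set \<Rightarrow> ('a set \<Rightarrow> 'a) \<Rightarrow> bool" where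
  "ranked \<H> rk \<longleftrightarrow> (\<forall>i. small i {H \<in> \<H>. rk H \<le> i})"

lemma small_finite: "finite X \<Longrightarrow> small i X"
  by (simp add: small_def)

lemma small_ordLeq: "small i X \<Longrightarrow> |Y| \<le>o |X| \<Longrightarrow> small i Y"
  unfolding small_def using card_of_ordLeq_finite ordLeq_transitive by blast

lemma small_subset: "small i X \<Longrightarrow> Y \<subseteq> X \<Longrightarrow> small i Y"
  by (rule small_ordLeq) (auto simp: card_of_mono1)

lemma small_finite_under: "finite {..<i} \<Longrightarrow> small i X \<longleftrightarrow> finite X"
  unfolding small_def using card_of_ordLeq_finite by blast

lemma small_infinite_under: "infinite {..<i} \<Longrightarrow> small i X \<longleftrightarrow> |X| \<le>o |{..<i}|"
  unfolding small_def using finite_ordLess ordLess_imp_ordLeq by blast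

lemma small_UN:
  assumes "small i I" "\<And>x. x \<in> I \<Longrightarrow> small i (X x)"
  shows "small i (\<Union>x\<in>I. X x)"
proof (cases "finite {..<i}")
  case True
  then show ?thesis using assms by (simp add: small_finite_under)
next
  case False
  then show ?thesis using assms card_of_UNION_ordLeq_infinite[OF False, of I X]
    by (simp add: small_infinite_under)
qed

lemma small_Un: "small i X \<Longrightarrow> small i Y \<Longrightarrow> small i (X \<union> Y)"
  using small_UN[of i "{True, False}" "\<lambda>b. if b then X else Y"] by (simp add: small_finite Un_commute)

lemma small_ordLess:
  assumes "small i X" "infinite A" "|{..<i}| <o |A|"
  shows "|X| <o |A|"
  using assms finite_ordLess ordLeq_ordLess_trans unfolding small_def by blast

text \<open>Of the relation between ranked sets and edges only the finiteness of intersections is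
  kept: one private edge then costs a ranked set a small number of points at every rank, and the
  property passes to traces.\<close>

definition admissible :: "'b rel set \<Rightarrow> nat \<Rightarrow> 'a set \<Rightarrow> 'a set set \<Rightarrow> 'a set set \<Rightarrow> ('a set \<Rightarrow> 'a) \<Rightarrow> bool" where
  "admissible S r A \<G> \<H> rk \<longleftrightarrow> \<G> \<subseteq> Pow A \<and> {} \<notin> \<G> \<and> sized S \<G> \<and> almost_disjoint r \<G> \<and>
     (\<forall>H\<in>\<H>. \<forall>E\<in>\<G>. finite (H \<inter> E)) \<and> ranked \<H> rk"

text \<open>A set that is hit is released from the bound on its loss: for an edge of full size,
  being hit means being covered.\<close>

definition solvable :: "'a set set \<Rightarrow> 'a set set \<Rightarrow> ('a set \<Rightarrow> 'a) \<Rightarrow> bool" where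
  "solvable \<G> \<H> rk \<longleftrightarrow> (\<exists>M. private_cover \<G> M \<and>
     (\<forall>H\<in>\<H>. H \<inter> pts M = {} \<longrightarrow> small (rk H) (H \<inter> cov M)))"

text \<open>
  The last clause bounds the number of lossy blocks when solutions of many blocks are put together.
\<close>

definition strongly_solvable :: "'a set set \<Rightarrow> 'a set set \<Rightarrow> ('a set \<Rightarrow> 'a) \<Rightarrow> bool" where
  "strongly_solvable \<G> \<H> rk \<longleftrightarrow> (\<exists>M. private_cover \<G> M \<and>
     (\<forall>H\<in>\<H>. H \<inter> pts M = {} \<longrightarrow> small (rk H) (H \<inter> cov M) \<and>
        (H \<inter> cov M \<noteq> {} \<longrightarrow> (\<exists>H'\<in>\<H>. rk H' \<le> rk H \<and> H' \<inter> pts M \<noteq> {}))))"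

lemma ranked_subset: "ranked \<H> rk \<Longrightarrow> \<H>' \<subseteq> \<H> \<Longrightarrow> ranked \<H>' rk"
  unfolding ranked_def by (blast intro: small_subset)

text \<open>An infinite edge that loses fewer points than it has keeps its cardinality, so
  \<open>sized\<close> is inherited; the other conditions only get weaker on smaller sets and
  families.\<close>

lemma admissible_traces:
  assumes adm: "admissible S r A \<G> \<H> rk"
    and "\<F> \<subseteq> \<G>" "\<H>' \<subseteq> \<H>"
    and tr: "\<And>E. E \<in> \<F> \<Longrightarrow> E - D \<subseteq> B \<and> E - D \<noteq> {} \<and> (finite E \<or> |E \<inter> D| <o |E| )"
  shows "admissible S r B (traces \<F> D) \<H>' rk"
proof -
  have "sized S (traces \<F> D)"
    unfolding sized_def traces_def
  proof (clarify)
    fix E assume E: "E \<in> \<F>" "\<not> (\<exists>\<kappa>\<in>S. |E - D| =o \<kappa>)"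
    show "finite (E - D)"
    proof (rule ccontr)
      assume inf: "infinite (E - D)"
      then have "infinite E" by blast
      then obtain \<kappa> where "\<kappa> \<in> S" "|E| =o \<kappa>"
        using adm E(1) assms(2) unfolding admissible_def sized_def by blast
      moreover have "|E - D| =o |E|" using tr[OF E(1)] \<open>infinite E\<close> ordIso_Diff by blast
      ultimately show False using E(2) ordIso_transitive by blast
    qed
  qed
  moreover have "almost_disjoint r (traces \<F> D)"
    using adm assms(2) by (auto intro: almost_disjoint_traces almost_disjoint_subset simp: admissible_def)
  moreover have "\<forall>H\<in>\<H>'. \<forall>E\<in>traces \<F> D. finite (H \<inter> E)"
  proof (intro ballI)
    fix H T assume "H \<in> \<H>'" "T \<in> traces \<F> D"
    then obtain E where "E \<in> \<F>" "T = E - D" by (auto simp: traces_def)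
    then have "E \<in> \<G>" "H \<in> \<H>" "H \<inter> T \<subseteq> H \<inter> E" using assms(2,3) \<open>H \<in> \<H>'\<close> by auto
    moreover from this have "finite (H \<inter> E)" using adm unfolding admissible_def by blast
    ultimately show "finite (H \<inter> T)" using finite_subset by blast
  qed
  moreover have "ranked \<H>' rk"
    using adm assms(3) ranked_subset unfolding admissible_def by blast
  ultimately show ?thesis
    using tr by (force simp: admissible_def traces_def)
qed

lemma almost_disjoint_ordLess:
  assumes "almost_disjoint r \<G>" "E \<in> \<G>" "E' \<in> \<G>" "E \<noteq> E'"
  shows "finite E \<or> |E \<inter> E'| <o |E|"
  using almost_disjointD[OF assms] finite_ordLess by blast

text \<open>
  After passing to inclusion-minimal edges, the set of least rank that meets an edge at all is hit
  first. The sets of smaller rank cannot lose any point.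
\<close>

lemma strongly_solvable_if_traces_solvable:
  assumes adm: "admissible S r A \<G> \<H> rk"
    and solv: "\<And>\<G>' \<H>'. admissible S r A \<G>' \<H>' rk \<Longrightarrow> solvable \<G>' \<H>' rk"
  shows "strongly_solvable \<G> \<H> rk"
proof -
  define \<G>m where "\<G>m = {E\<in>\<G>. \<forall>E'\<in>\<G>. E' \<subseteq> E \<longrightarrow> E' = E}"
  have sub: "\<G>m \<subseteq> \<G>" by (auto simp: \<G>m_def)
  have ad: "almost_disjoint r \<G>" using adm by (simp add: admissible_def)
  have fin: "finite (H \<inter> E)" if "H \<in> \<H>" "E \<in> \<G>m" for H E
    using adm that sub by (auto simp: admissible_def)
  have below: "\<exists>T\<in>\<G>m. T \<subseteq> E" if E: "E \<in> \<G>" for E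
  proof -
    obtain T where "T \<in> \<G>" "T \<subseteq> E" "\<And>T'. T' \<in> \<G> \<Longrightarrow> T' \<subseteq> T \<Longrightarrow> T' = T"
      using exists_minimal_member[OF ad E] by blast
    then show ?thesis by (auto simp: \<G>m_def)
  qed
  have cover: "private_cover \<G> M" if M: "private_cover \<G>m M" for M
  proof -
    have "E \<inter> pts M \<noteq> {}" if E: "E \<in> \<G>" for E
    proof -
      obtain T where "T \<in> \<G>m" "T \<subseteq> E" using below[OF E] by blast
      then have "T \<inter> pts M \<noteq> {}" using M by (simp add: private_cover_def)
      then show ?thesis using \<open>T \<subseteq> E\<close> by blast
    qed
    moreover have "snd ` M \<subseteq> \<G>" using M sub by (auto simp: private_cover_def)
    ultimately show ?thesis using M by (simp add: private_cover_def)
  qed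
  have adm_m: "admissible S r A \<G>m \<H> rk"
    using adm sub almost_disjoint_subset sized_subset by (auto simp: admissible_def)
  show ?thesis
  proof (cases "\<exists>H\<in>\<H>. H \<inter> \<Union>\<G>m \<noteq> {}")
    \<comment> \<open>All private edges can be taken minimal, and no ranked set meets a minimal
      edge, so nothing is lost.\<close>
    case False
    obtain M where M: "private_cover \<G>m M" using solv[OF adm_m] unfolding solvable_def by blast
    have "cov M \<subseteq> \<Union>\<G>m" using M by (auto simp: private_cover_def cov_def)
    then have "H \<inter> cov M = {}" if "H \<in> \<H>" for H using False that by blast
    then have "\<forall>H\<in>\<H>. H \<inter> pts M = {} \<longrightarrow> small (rk H) (H \<inter> cov M) \<and>
        (H \<inter> cov M \<noteq> {} \<longrightarrow> (\<exists>H'\<in>\<H>. rk H' \<le> rk H \<and> H' \<inter> pts M \<noteq> {}))"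
      by (simp add: small_finite)
    then show ?thesis using cover[OF M] unfolding strongly_solvable_def by blast
  next
    case True
    then obtain H1 where H1: "H1 \<in> \<H>" "H1 \<inter> \<Union>\<G>m \<noteq> {}" by blast
    define i where "i = (LEAST i. \<exists>H\<in>\<H>. H \<inter> \<Union>\<G>m \<noteq> {} \<and> rk H = i)"
    have "\<exists>H\<in>\<H>. H \<inter> \<Union>\<G>m \<noteq> {} \<and> rk H = i" unfolding i_def
      by (rule LeastI[of _ "rk H1"]) (use H1 in blast)
    then obtain H0 where H0: "H0 \<in> \<H>" "H0 \<inter> \<Union>\<G>m \<noteq> {}" "rk H0 = i" by blast
    have least: "rk H0 \<le> rk H" if "H \<in> \<H>" "H \<inter> \<Union>\<G>m \<noteq> {}" for H
      unfolding H0(3) i_def by (rule Least_le) (use that in blast)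
    obtain v E0 where v: "v \<in> H0" "v \<in> E0" "E0 \<in> \<G>m" using H0(2) by blast
    \<comment> \<open>Edges and sets through \<open>v\<close> are hit by \<open>v\<close> and drop
      out, which also keeps \<open>v\<close> out of all further private edges. From the remaining
      edges the points of \<open>E0\<close> are removed, so that no further vertex enters the
      private edge of \<open>v\<close>.\<close>
    define \<F> where "\<F> = {E\<in>\<G>m. v \<notin> E}"
    define \<H>' where "\<H>' = {H\<in>\<H>. v \<notin> H}"
    have "admissible S r A (traces \<F> E0) \<H>' rk"
    proof (rule admissible_traces[OF adm_m])
      show "\<F> \<subseteq> \<G>m" "\<H>' \<subseteq> \<H>" by (auto simp: \<F>_def \<H>'_def)
      fix E assume E: "E \<in> \<F>"
      then have ne: "E \<noteq> E0" "E \<in> \<G>" "E0 \<in> \<G>" "E \<subseteq> A"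
        using v sub adm by (auto simp: \<F>_def admissible_def)
      \<comment> \<open>By minimality of \<open>E0\<close>, an edge inside \<open>E0\<close> would
        be \<open>E0\<close> itself.\<close>
      then have "E - E0 \<noteq> {}" using v(3) by (auto simp: \<G>m_def)
      then show "E - E0 \<subseteq> A \<and> E - E0 \<noteq> {} \<and> (finite E \<or> |E \<inter> E0| <o |E| )"
        using almost_disjoint_ordLess[OF ad ne(2,3,1)] ne(4) by blast
    qed
    from solv[OF this] obtain M' where M': "private_cover (traces \<F> E0) M'"
      "\<forall>H\<in>\<H>'. H \<inter> pts M' = {} \<longrightarrow> small (rk H) (H \<inter> cov M')"
      unfolding solvable_def by blast
    obtain N where N: "pts N = pts M'" "snd ` N \<subseteq> \<F>" "private_edges N" "cov N - E0 = cov M'"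
      "pts N \<inter> E0 = {}" "\<forall>E\<in>\<F>. E \<inter> pts N \<noteq> {}"
      using lift_traces[OF M'(1)] .
    define M where "M = insert (v, E0) N"
    have pM: "pts M = insert v (pts N)" and cM: "cov M = E0 \<union> cov N"
      by (auto simp: M_def pts_def cov_def)
    have "private_edges M"
      unfolding private_edges_def
    proof (clarify)
      fix y E assume yE: "(y, E) \<in> M"
      show "E \<inter> pts M = {y}"
      proof (cases "(y, E) = (v, E0)")
        case True
        then show ?thesis using N(5) v(2) pM by auto
      next
        case False
        then have yN: "(y, E) \<in> N" using yE unfolding M_def by blast
        then have "E \<in> snd ` N" by force
        then have "v \<notin> E" using N(2) unfolding \<F>_def by blast
        moreover have "E \<inter> pts N = {y}" using yN N(3) unfolding private_edges_def by blast
        ultimately show ?thesis by (simp add: pM)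
      qed
    qed
    moreover have "snd ` M \<subseteq> \<G>m" using N(2) v(3) unfolding M_def \<F>_def by auto
    moreover have "E \<inter> pts M \<noteq> {}" if "E \<in> \<G>m" for E
      using N(6) that pM by (cases "v \<in> E") (auto simp: \<F>_def)
    ultimately have pc: "private_cover \<G>m M" by (auto simp: private_cover_def)
    have "small (rk H) (H \<inter> cov M) \<and> (H \<inter> cov M \<noteq> {} \<longrightarrow> (\<exists>H'\<in>\<H>. rk H' \<le> rk H \<and> H' \<inter> pts M \<noteq> {}))"
      if H: "H \<in> \<H>" "H \<inter> pts M = {}" for H
    proof
      have "H \<in> \<H>'" "H \<inter> pts M' = {}" using H pM N(1) by (auto simp: \<H>'_def)
      then have "small (rk H) (H \<inter> cov M')" using M'(2) by blast
      moreover have "small (rk H) (H \<inter> E0)" using fin[OF H(1) v(3)] by (rule small_finite)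
      ultimately have "small (rk H) (H \<inter> cov M' \<union> H \<inter> E0)" by (rule small_Un)
      then show "small (rk H) (H \<inter> cov M)"
        by (rule small_subset) (use cM N(4) in blast)
      show "H \<inter> cov M \<noteq> {} \<longrightarrow> (\<exists>H'\<in>\<H>. rk H' \<le> rk H \<and> H' \<inter> pts M \<noteq> {})"
      proof
        assume "H \<inter> cov M \<noteq> {}"
        moreover have "cov M \<subseteq> \<Union>\<G>m" using pc by (auto simp: private_cover_def cov_def)
        ultimately have "rk H0 \<le> rk H" using least[OF H(1)] by blast
        then show "\<exists>H'\<in>\<H>. rk H' \<le> rk H \<and> H' \<inter> pts M \<noteq> {}" using H0(1) v(1) pM by blast
      qed
    qed
    then show ?thesis using cover[OF pc] unfolding strongly_solvable_def by blast
  qed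
qed


section \<open>Extending a partial cover and assembling blocks\<close>

text \<open>
  \<open>N\<close> can be added to \<open>M\<close>; the second part is the clause of \<open>strongly_solvable\<close> for the points
  newly used up and the sets newly hit.
\<close>

definition extends :: "'a set set \<Rightarrow> ('a set \<Rightarrow> 'a) \<Rightarrow> ('a \<times> 'a set) set \<Rightarrow> ('a \<times> 'a set) set \<Rightarrow> bool" where
  "extends \<H> rk M N \<longleftrightarrow>
     (\<forall>(y, E)\<in>N. y \<notin> cov M \<and> E \<inter> pts M = {} \<and> E \<inter> pts N = {y}) \<and>
     (\<forall>H\<in>\<H>. H \<inter> pts M = {} \<longrightarrow> H \<inter> pts N = {} \<longrightarrow>
        small (rk H) (H \<inter> cov N - cov M) \<and>
        (H \<inter> cov N - cov M \<noteq> {} \<longrightarrow> (\<exists>H'\<in>\<H>. rk H' \<le> rk H \<and> H' \<inter> pts M = {} \<and> H' \<inter> pts N \<noteq> {})))"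

lemma extendsD1:
  assumes "extends \<H> rk M N" "(y, E) \<in> N"
  shows "y \<notin> cov M \<and> E \<inter> pts M = {} \<and> E \<inter> pts N = {y}"
proof -
  have "\<forall>(y, E)\<in>N. y \<notin> cov M \<and> E \<inter> pts M = {} \<and> E \<inter> pts N = {y}"
    using assms(1) unfolding extends_def by (rule conjunct1)
  from bspec[OF this assms(2)] show ?thesis by simp
qed

lemma extendsD2:
  assumes "extends \<H> rk M N" "H \<in> \<H>" "H \<inter> pts M = {}" "H \<inter> pts N = {}"
  shows "small (rk H) (H \<inter> cov N - cov M) \<and>
    (H \<inter> cov N - cov M \<noteq> {} \<longrightarrow> (\<exists>H'\<in>\<H>. rk H' \<le> rk H \<and> H' \<inter> pts M = {} \<and> H' \<inter> pts N \<noteq> {}))"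
proof -
  have "\<forall>H\<in>\<H>. H \<inter> pts M = {} \<longrightarrow> H \<inter> pts N = {} \<longrightarrow> small (rk H) (H \<inter> cov N - cov M) \<and>
    (H \<inter> cov N - cov M \<noteq> {} \<longrightarrow> (\<exists>H'\<in>\<H>. rk H' \<le> rk H \<and> H' \<inter> pts M = {} \<and> H' \<inter> pts N \<noteq> {}))"
    using assms(1) unfolding extends_def by (rule conjunct2)
  from bspec[OF this assms(2)] show ?thesis using assms(3,4) by simp
qed

lemma extends_empty: "extends \<H> rk M {}"
  by (simp add: extends_def small_finite)

text \<open>Only sets not hit by \<open>M\<close> take part, so the witnesses supplied by strong
  solvability are newly hit. Removing \<open>cov M\<close> keeps new vertices out of old private
  edges; taking \<F> among the unhit edges keeps old vertices out of new private edges.\<close>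

lemma extends_block:
  assumes solv: "strongly_solvable (traces \<F> (cov M)) {H\<in>\<H>. H \<inter> pts M = {}} rk"
    and unhit: "\<And>E. E \<in> \<F> \<Longrightarrow> E \<inter> pts M = {}"
  obtains N where "extends \<H> rk M N" "snd ` N \<subseteq> \<F>" "\<forall>E\<in>\<F>. E \<inter> pts N \<noteq> {}"
proof -
  obtain M' where M': "private_cover (traces \<F> (cov M)) M'"
    "\<forall>H\<in>{H\<in>\<H>. H \<inter> pts M = {}}. H \<inter> pts M' = {} \<longrightarrow> small (rk H) (H \<inter> cov M') \<and>
        (H \<inter> cov M' \<noteq> {} \<longrightarrow> (\<exists>H'\<in>{H\<in>\<H>. H \<inter> pts M = {}}. rk H' \<le> rk H \<and> H' \<inter> pts M' \<noteq> {}))"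
    using solv unfolding strongly_solvable_def by blast
  obtain N where N: "pts N = pts M'" "snd ` N \<subseteq> \<F>" "private_edges N" "cov N - cov M = cov M'"
    "pts N \<inter> cov M = {}" "\<forall>E\<in>\<F>. E \<inter> pts N \<noteq> {}"
    using lift_traces[OF M'(1)] .
  have "y \<notin> cov M \<and> E \<inter> pts M = {} \<and> E \<inter> pts N = {y}" if yE: "(y, E) \<in> N" for y E
  proof -
    have "y \<in> pts N" "E \<in> snd ` N" using yE by (force simp: pts_def)+
    then have "y \<notin> cov M" "E \<in> \<F>" using N(2,5) by auto
    moreover have "E \<inter> pts N = {y}" using yE N(3) unfolding private_edges_def by auto
    ultimately show ?thesis using unhit by simp
  qed
  then have 1: "\<forall>(y, E)\<in>N. y \<notin> cov M \<and> E \<inter> pts M = {} \<and> E \<inter> pts N = {y}" by blast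
  have 2: "small (rk H) (H \<inter> cov N - cov M) \<and>
        (H \<inter> cov N - cov M \<noteq> {} \<longrightarrow> (\<exists>H'\<in>\<H>. rk H' \<le> rk H \<and> H' \<inter> pts M = {} \<and> H' \<inter> pts N \<noteq> {}))"
    if H: "H \<in> \<H>" "H \<inter> pts M = {}" "H \<inter> pts N = {}" for H
  proof -
    have "H \<inter> cov N - cov M = H \<inter> cov M'" using N(4) by blast
    moreover have "small (rk H) (H \<inter> cov M') \<and>
        (H \<inter> cov M' \<noteq> {} \<longrightarrow> (\<exists>H'\<in>{H\<in>\<H>. H \<inter> pts M = {}}. rk H' \<le> rk H \<and> H' \<inter> pts M' \<noteq> {}))"
      using M'(2) H N(1) by simp
    ultimately show ?thesis using N(1) by auto
  qed
  have "extends \<H> rk M N" unfolding extends_def using 1 2 by simp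
  then show thesis using that N(2,6) by blast
qed

lemma extends_single:
  assumes unhit: "E \<inter> pts M = {}" and ne: "E - cov M \<noteq> {}"
    and fin: "\<And>H. H \<in> \<H> \<Longrightarrow> H \<noteq> E \<Longrightarrow> finite (H \<inter> E)"
  obtains v where "v \<in> E - cov M" "extends \<H> rk M {(v, E)}"
proof -
  let ?P = "\<lambda>H. H \<in> \<H> \<and> H \<inter> pts M = {} \<and> H \<inter> (E - cov M) \<noteq> {}"
  have "\<exists>v\<in>E - cov M. \<forall>H. ?P H \<longrightarrow> (\<exists>H'\<in>\<H>. rk H' \<le> rk H \<and> H' \<inter> pts M = {} \<and> v \<in> H')"
  proof (cases "\<exists>H. ?P H")
    case False
    then show ?thesis using ne by blast
  next
    case True
    define i where "i = (LEAST i. \<exists>H. ?P H \<and> rk H = i)"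
    have "\<exists>H. ?P H \<and> rk H = i" unfolding i_def by (rule LeastI_ex) (use True in blast)
    then obtain H0 where H0: "?P H0" "rk H0 = i" by blast
    have least: "rk H0 \<le> rk H" if "?P H" for H
      unfolding H0(2) i_def by (rule Least_le) (use that in blast)
    obtain v where "v \<in> H0" "v \<in> E - cov M" using H0(1) by blast
    then show ?thesis using H0(1) least by blast
  qed
  then obtain v where v: "v \<in> E - cov M"
    "\<And>H. ?P H \<Longrightarrow> \<exists>H'\<in>\<H>. rk H' \<le> rk H \<and> H' \<inter> pts M = {} \<and> v \<in> H'" by blast
  have "small (rk H) (H \<inter> E - cov M) \<and> (H \<inter> E - cov M \<noteq> {} \<longrightarrow>
      (\<exists>H'\<in>\<H>. rk H' \<le> rk H \<and> H' \<inter> pts M = {} \<and> H' \<inter> {v} \<noteq> {}))"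
    if H: "H \<in> \<H>" "H \<inter> pts M = {}" "H \<inter> {v} = {}" for H
  proof
    have "H \<noteq> E" using H(3) v(1) by blast
    then have "finite (H \<inter> E)" using fin H(1) by blast
    then show "small (rk H) (H \<inter> E - cov M)" by (simp add: small_finite)
    show "H \<inter> E - cov M \<noteq> {} \<longrightarrow> (\<exists>H'\<in>\<H>. rk H' \<le> rk H \<and> H' \<inter> pts M = {} \<and> H' \<inter> {v} \<noteq> {})"
    proof
      assume "H \<inter> E - cov M \<noteq> {}"
      then have "?P H" using H(1,2) by (simp add: Int_Diff)
      from v(2)[OF this] show "\<exists>H'\<in>\<H>. rk H' \<le> rk H \<and> H' \<inter> pts M = {} \<and> H' \<inter> {v} \<noteq> {}" by simp
    qed
  qed
  then have "extends \<H> rk M {(v, E)}"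
    unfolding extends_def using v(1) unhit by simp
  then show thesis using that v(1) by blast
qed

text \<open>
  Distinct blocks at which an unhit set \<open>H\<close> loses points hit for the first time distinct sets of
  at most the rank of \<open>H\<close>.
\<close>

lemma assembly:
  assumes wf: "wf R" and trans: "trans R" and total: "total_on I R"
    and ranked: "ranked \<H> rk"
    and ext: "\<And>x. x \<in> I \<Longrightarrow> extends \<H> rk (\<Union>y\<in>{y\<in>I. (y, x) \<in> R}. N y) (N x)"
  shows "private_edges (\<Union>x\<in>I. N x)"
    and "\<And>H. H \<in> \<H> \<Longrightarrow> H \<inter> pts (\<Union>x\<in>I. N x) = {} \<Longrightarrow> small (rk H) (H \<inter> cov (\<Union>x\<in>I. N x))"
proof -
  define M where "M x = (\<Union>y\<in>{y\<in>I. (y, x) \<in> R}. N y)" for x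
  have ext1: "y \<notin> cov (M x) \<and> E \<inter> pts (M x) = {} \<and> E \<inter> pts (N x) = {y}"
    if "x \<in> I" "(y, E) \<in> N x" for x y E
    using extendsD1[OF ext[OF that(1)] that(2)] unfolding M_def .
  have ext2: "small (rk H) (H \<inter> cov (N x) - cov (M x)) \<and>
        (H \<inter> cov (N x) - cov (M x) \<noteq> {} \<longrightarrow>
          (\<exists>H'\<in>\<H>. rk H' \<le> rk H \<and> H' \<inter> pts (M x) = {} \<and> H' \<inter> pts (N x) \<noteq> {}))"
    if "x \<in> I" "H \<in> \<H>" "H \<inter> pts (M x) = {}" "H \<inter> pts (N x) = {}" for x H
    using extendsD2[OF ext[OF that(1)] that(2) _ that(4)] that(3) unfolding M_def by simp
  have pts_M: "pts (N y) \<subseteq> pts (M x)" and cov_M: "cov (N y) \<subseteq> cov (M x)"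
    if "y \<in> I" "(y, x) \<in> R" for x y
    using that by (auto simp: M_def pts_UN cov_UN)
  have "E \<inter> pts (\<Union>x\<in>I. N x) = {y}" if x: "x \<in> I" "(y, E) \<in> N x" for x y E
  proof -
    have "E \<inter> pts (N z) \<subseteq> {y}" if z: "z \<in> I" for z
    proof (cases "z = x")
      case True
      then show ?thesis using ext1[OF x] by simp
    next
      case False
      then consider "(z, x) \<in> R" | "(x, z) \<in> R" using total z x(1) by (auto simp: total_on_def)
      then show ?thesis
      proof cases
        case 1
        then show ?thesis using pts_M[OF z] ext1[OF x] by blast
      next
        case 2
        have "E \<subseteq> cov (N x)" using x(2) by (force simp: cov_def)
        then have "E \<subseteq> cov (M z)" using cov_M[OF x(1) 2] by blast
        moreover have "pts (N z) \<inter> cov (M z) = {}" using ext1[OF z] by (auto simp: pts_def)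
        ultimately show ?thesis by blast
      qed
    qed
    moreover have "y \<in> E \<inter> pts (N x)" using ext1[OF x] by simp
    ultimately show ?thesis using x(1) unfolding pts_UN by blast
  qed
  then show "private_edges (\<Union>x\<in>I. N x)" unfolding private_edges_def by blast
  fix H assume H: "H \<in> \<H>" "H \<inter> pts (\<Union>x\<in>I. N x) = {}"
  define Bad where "Bad = {x\<in>I. H \<inter> cov (N x) - cov (M x) \<noteq> {}}"
  have HM: "H \<inter> pts (M x) = {}" "H \<inter> pts (N x) = {}" if "x \<in> I" for x
    using H(2) that by (auto simp: M_def pts_UN)
  have "\<exists>H'\<in>\<H>. rk H' \<le> rk H \<and> H' \<inter> pts (M x) = {} \<and> H' \<inter> pts (N x) \<noteq> {}" if "x \<in> Bad" for x
    using ext2[OF _ H(1) HM] that by (auto simp: Bad_def)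
  then obtain h where h: "\<And>x. x \<in> Bad \<Longrightarrow> h x \<in> \<H> \<and> rk (h x) \<le> rk H \<and>
      h x \<inter> pts (M x) = {} \<and> h x \<inter> pts (N x) \<noteq> {}" by metis
  have "inj_on h Bad"
  proof (rule inj_onI, rule ccontr)
    fix x y assume xy: "x \<in> Bad" "y \<in> Bad" "h x = h y" "x \<noteq> y"
    have no: False if ab: "a \<in> Bad" "b \<in> Bad" "h a = h b" "(a, b) \<in> R" for a b
    proof -
      have "pts (N a) \<subseteq> pts (M b)" using ab pts_M by (auto simp: Bad_def)
      then show False using h[OF ab(1)] h[OF ab(2)] ab(3) by auto
    qed
    have "(x, y) \<in> R \<or> (y, x) \<in> R" using total xy by (auto simp: total_on_def Bad_def)
    then show False using no[OF xy(1,2,3)] no[OF xy(2,1)] xy(3) by auto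
  qed
  moreover have "h ` Bad \<subseteq> {H'\<in>\<H>. rk H' \<le> rk H}" using h by blast
  ultimately have "|Bad| \<le>o |{H'\<in>\<H>. rk H' \<le> rk H}|" using card_of_ordLeq by blast
  then have "small (rk H) Bad" using ranked small_ordLeq unfolding ranked_def by blast
  then have "small (rk H) (\<Union>x\<in>Bad. H \<inter> cov (N x) - cov (M x))"
  proof (rule small_UN)
    fix x assume "x \<in> Bad"
    then have "x \<in> I" by (simp add: Bad_def)
    then show "small (rk H) (H \<inter> cov (N x) - cov (M x))" using ext2[OF _ H(1) HM] by blast
  qed
  \<comment> \<open>Each lost point is charged to the first block that uses it. There it is not yet
    in \<open>cov (M x)\<close>, so this block belongs to \<open>Bad\<close>.\<close>
  moreover have "H \<inter> cov (\<Union>x\<in>I. N x) \<subseteq> (\<Union>x\<in>Bad. H \<inter> cov (N x) - cov (M x))"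
  proof
    fix z assume z: "z \<in> H \<inter> cov (\<Union>x\<in>I. N x)"
    let ?Q = "{x\<in>I. z \<in> cov (N x)}"
    obtain x0 where "x0 \<in> ?Q" using z by (auto simp: cov_UN)
    then obtain x where x: "x \<in> ?Q" "\<And>y. (y, x) \<in> R \<Longrightarrow> y \<notin> ?Q"
      using wfE_min[OF wf, of x0 ?Q] by blast
    have "z \<notin> cov (M x)" using x(2) by (auto simp: M_def cov_UN)
    then have "z \<in> H \<inter> cov (N x) - cov (M x)" using z x(1) by blast
    then show "z \<in> (\<Union>x\<in>Bad. H \<inter> cov (N x) - cov (M x))" using x(1) unfolding Bad_def by blast
  qed
  ultimately show "small (rk H) (H \<inter> cov (\<Union>x\<in>I. N x))" by (rule small_subset)
qed

end

text \<open>An infinite edge is determined by any \<open>r\<close> of its points.\<close>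

lemma inj_finite_subsets:
  assumes ad: "almost_disjoint r \<G>" and sub: "\<G> \<subseteq> Pow A"
  obtains \<phi> where "inj_on \<phi> {E\<in>\<G>. infinite E}" "\<phi> ` {E\<in>\<G>. infinite E} \<subseteq> {F. finite F \<and> F \<subseteq> A}"
proof -
  have "\<forall>E\<in>{E\<in>\<G>. infinite E}. \<exists>F. F \<subseteq> E \<and> finite F \<and> card F = r"
    using infinite_arbitrarily_large by blast
  then obtain \<phi> where \<phi>: "\<And>E. E \<in> {E\<in>\<G>. infinite E} \<Longrightarrow> \<phi> E \<subseteq> E \<and> finite (\<phi> E) \<and> card (\<phi> E) = r"
    by metis
  have "inj_on \<phi> {E\<in>\<G>. infinite E}"
  proof (rule inj_onI, rule ccontr)
    fix E E' assume E: "E \<in> {E\<in>\<G>. infinite E}" "E' \<in> {E\<in>\<G>. infinite E}" "\<phi> E = \<phi> E'" "E \<noteq> E'"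
    have "\<phi> E \<subseteq> E \<inter> E'" using \<phi>[OF E(1)] \<phi>[OF E(2)] E(3) by auto
    moreover have *: "finite (E \<inter> E') \<and> card (E \<inter> E') < r" using almost_disjointD[OF ad] E by blast
    ultimately have "card (\<phi> E) \<le> card (E \<inter> E')" using card_mono by blast
    then show False using \<phi>[OF E(1)] * by linarith
  qed
  moreover have "\<phi> ` {E\<in>\<G>. infinite E} \<subseteq> {F. finite F \<and> F \<subseteq> A}"
  proof
    fix F assume "F \<in> \<phi> ` {E\<in>\<G>. infinite E}"
    then obtain E where "E \<in> {E\<in>\<G>. infinite E}" "F = \<phi> E" by blast
    then show "F \<in> {F. finite F \<and> F \<subseteq> A}" using \<phi>[of E] sub by blast
  qed
  ultimately show thesis using that by blast
qed

section \<open>Countably many vertices\<close>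

context wellorder
begin

text \<open>
  The \<open>n\<close>-th step treats the \<open>n\<close>-th edge. As private edge it takes one whose unused part is
  inclusion-minimal; therefore no edge that is not yet hit is ever used up.
\<close>

lemma solvable_countable:
  assumes adm: "admissible S r A \<G> \<H> rk" and A: "countable A"
  shows "solvable \<G> \<H> rk"
proof (cases "\<G> = {}")
  case True
  have "private_cover \<G> {}" by (simp add: True private_cover_def private_edges_def)
  then show ?thesis unfolding solvable_def by (intro exI[of _ "{}"]) (simp add: small_finite)
next
  case False
  have ad: "almost_disjoint r \<G>" and sub: "\<G> \<subseteq> Pow A" and ne: "{} \<notin> \<G>" and rkd: "ranked \<H> rk"
    and fin: "\<And>H E. H \<in> \<H> \<Longrightarrow> E \<in> \<G> \<Longrightarrow> finite (H \<inter> E)"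
    using adm by (auto simp: admissible_def)
  obtain \<phi> where \<phi>: "inj_on \<phi> {E\<in>\<G>. infinite E}" "\<phi> ` {E\<in>\<G>. infinite E} \<subseteq> {F. finite F \<and> F \<subseteq> A}"
    using inj_finite_subsets[OF ad sub] .
  have cF: "countable {F. finite F \<and> F \<subseteq> A}" using A by (rule countable_Collect_finite_subset)
  have "countable {E\<in>\<G>. infinite E}"
    using countable_image_inj_on[OF countable_subset[OF \<phi>(2) cF] \<phi>(1)] .
  moreover have "countable {E\<in>\<G>. finite E}"
    by (rule countable_subset[OF _ cF]) (use sub in auto)
  moreover have "\<G> = {E\<in>\<G>. infinite E} \<union> {E\<in>\<G>. finite E}" by blast
  ultimately have "countable \<G>" using countable_Un by metis
  define e where "e = from_nat_into \<G>"
  have range_e: "range e = \<G>" using range_from_nat_into[OF False \<open>countable \<G>\<close>] by (simp add: e_def)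
  let ?P = "\<lambda>n M. (n = (0::nat) \<longrightarrow> M = {}) \<and> (\<forall>E\<in>\<G>. E \<inter> pts M = {} \<longrightarrow> E - cov M \<noteq> {})"
  let ?Q = "\<lambda>n M M'. \<exists>N. M' = M \<union> N \<and> extends \<H> rk M N \<and> snd ` N \<subseteq> \<G> \<and> e n \<inter> pts M' \<noteq> {}"
  have "\<exists>f. \<forall>n. ?P n (f n) \<and> ?Q n (f n) (f (Suc n))"
  proof (rule dependent_nat_choice)
    show "\<exists>M. ?P 0 M" by (rule exI[of _ "{}"]) (use ne in auto)
    fix M n assume inv: "?P n M"
    have en: "e n \<in> \<G>" using range_e by blast
    show "\<exists>M'. ?P (Suc n) M' \<and> ?Q n M M'"
    proof (cases "e n \<inter> pts M = {}")
      case False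
      then show ?thesis using inv extends_empty by (intro exI[of _ M]) auto
    next
      case True
      let ?F = "{E\<in>\<G>. E \<inter> pts M = {}}"
      have adF: "almost_disjoint r (traces ?F (cov M))"
        by (rule almost_disjoint_traces, rule almost_disjoint_subset[OF ad]) blast
      \<comment> \<open>The minimal trace is taken below the trace of \<open>e n\<close>. Thus the
        new vertex lies in \<open>e n\<close>, although its private edge \<open>E\<close> may be a
        different edge.\<close>
      have "e n - cov M \<in> traces ?F (cov M)" using True en by (auto simp: traces_def)
      from exists_minimal_member[OF adF this]
      obtain T where T: "T \<in> traces ?F (cov M)" "T \<subseteq> e n - cov M"
        "\<And>T'. T' \<in> traces ?F (cov M) \<Longrightarrow> T' \<subseteq> T \<Longrightarrow> T' = T" by blast
      then obtain E where E: "E \<in> \<G>" "E \<inter> pts M = {}" "T = E - cov M" by (auto simp: traces_def)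
      have neE: "E - cov M \<noteq> {}" using inv E(1,2) by simp
      have finE: "finite (H \<inter> E)" if "H \<in> \<H>" "H \<noteq> E" for H using fin that(1) E(1) .
      obtain v where v: "v \<in> E - cov M" "extends \<H> rk M {(v, E)}"
        using extends_single[OF E(2) neE finE] .
      let ?M = "M \<union> {(v, E)}"
      have inv': "E' - cov ?M \<noteq> {}" if E': "E' \<in> \<G>" "E' \<inter> pts ?M = {}" for E'
      proof
        assume "E' - cov ?M = {}"
        then have "E' - cov M \<subseteq> T" using E(3) by auto
        moreover have "E' - cov M \<in> traces ?F (cov M)" using E' by (auto simp: traces_def)
        ultimately have "E' - cov M = T" using T(3) by blast
        then have "v \<in> E'" using v(1) E(3) by blast
        then show False using E'(2) by simp
      qed
      have "e n \<inter> pts ?M \<noteq> {}" using v(1) T(2) E(3) by auto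
      then have q: "?Q n M ?M" using v(2) E(1) by (intro exI[of _ "{(v, E)}"] conjI) simp_all
      have p1: "Suc n = 0 \<longrightarrow> ?M = {}" by simp
      have p2: "\<forall>E\<in>\<G>. E \<inter> pts ?M = {} \<longrightarrow> E - cov ?M \<noteq> {}" using inv' by simp
      show ?thesis by (rule exI[of _ ?M], rule conjI[OF conjI[OF p1 p2] q])
    qed
  qed
  then obtain f where f: "\<forall>n. ?P n (f n) \<and> ?Q n (f n) (f (Suc n))" by (rule exE)
  have "\<forall>n. ?Q n (f n) (f (Suc n))" using f by simp
  from choice[OF this] obtain N where N': "\<forall>n. f (Suc n) = f n \<union> N n \<and> extends \<H> rk (f n) (N n) \<and>
      snd ` N n \<subseteq> \<G> \<and> e n \<inter> pts (f (Suc n)) \<noteq> {}" by (rule exE)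
  have N: "f (Suc n) = f n \<union> N n" "extends \<H> rk (f n) (N n)"
    "snd ` N n \<subseteq> \<G>" "e n \<inter> pts (f (Suc n)) \<noteq> {}" for n
    using N'[THEN spec, of n] by blast+
  have f0: "f 0 = {}" using f by simp
  have f_eq: "f n = (\<Union>m<n. N m)" for n
    by (induction n) (use f0 N(1) in \<open>auto simp: lessThan_Suc\<close>)
  define T where "T = (\<Union>n. N n)"
  have ext: "extends \<H> rk (\<Union>m\<in>{m\<in>UNIV. (m, n) \<in> less_than}. N m) (N n)" for n
  proof -
    have "{m\<in>UNIV. (m, n) \<in> less_than} = {..<n}" by auto
    then show ?thesis using N(2)[of n] f_eq by simp
  qed
  have "total less_than" by (auto simp: total_on_def)
  note asm = assembly[OF wf_less_than trans_less_than this rkd ext]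
  have "private_cover \<G> T"
    unfolding private_cover_def
  proof (intro conjI ballI)
    show "private_edges T" unfolding T_def by (rule asm(1))
    show "snd ` T \<subseteq> \<G>" using N(3) unfolding T_def by blast
    fix E assume "E \<in> \<G>"
    then obtain n where "E = e n" using range_e by blast
    moreover have "f (Suc n) \<subseteq> T" unfolding T_def f_eq by blast
    then have "pts (f (Suc n)) \<subseteq> pts T" by (auto simp: pts_def)
    ultimately show "E \<inter> pts T \<noteq> {}" using N(4)[of n] by blast
  qed
  moreover have "\<forall>H\<in>\<H>. H \<inter> pts T = {} \<longrightarrow> small (rk H) (H \<inter> cov T)"
    using asm(2) unfolding T_def by simp
  ultimately show ?thesis unfolding solvable_def by blast
qed

end

section \<open>Ordinals below a cardinal\<close>

lemma countable_iff_ordLeq_natLeq: "countable A \<longleftrightarrow> |A| \<le>o natLeq"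
proof -
  have "|A| \<le>o natLeq \<longleftrightarrow> |A| \<le>o |UNIV :: nat set|"
    using card_of_nat ordIso_symmetric ordLeq_ordIso_trans by blast
  also have "\<dots> \<longleftrightarrow> (\<exists>f :: _ \<Rightarrow> nat. inj_on f A)" by (simp flip: card_of_ordLeq)
  finally show ?thesis by (simp add: countable_def)
qed

context wellorder
begin

text \<open>The order of the context as a relation, to make embeddings and comparisons of
  well-orders available for it.\<close>

definition order_on :: "'a set \<Rightarrow> 'a rel" where
  "order_on J = {(x, y). x \<in> J \<and> y \<in> J \<and> x \<le> y}"

lemma Field_order_on [simp]: "Field (order_on J) = J"
  by (auto simp: order_on_def Field_def)

lemma underS_order_on: "j \<in> J \<Longrightarrow> underS (order_on J) j = J \<inter> {..<j}"
  by (auto simp: order_on_def underS_def)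

lemma Well_order_order_on: "Well_order (order_on J)"
proof -
  have "wf (order_on J - Id)"
    by (rule wf_subset[OF wf]) (auto simp: order_on_def less_le)
  moreover have "Refl (order_on J)" "trans (order_on J)" "antisym (order_on J)" "Total (order_on J)"
    by (auto simp: refl_on_def trans_def antisym_def total_on_def) (auto simp: order_on_def)
  ultimately show ?thesis
    by (simp add: well_order_on_def linear_order_on_def partial_order_on_def preorder_on_def)
       (auto simp: order_on_def)
qed

text \<open>The cardinal \<open>|J|\<close> is least among the well-orders on \<open>J\<close>, so
  \<open>|X|\<close> is isomorphic to a proper initial segment of \<open>order_on J\<close>; its end
  point is \<open>j\<close>.\<close>

lemma exists_ordLeq_lessThan:
  assumes "|X| <o |J|"
  obtains j where "j \<in> J" "|X| \<le>o |{..<j}|"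
proof -
  have "|J| \<le>o order_on J"
    using card_of_least[of J "order_on J"] Well_order_order_on[of J] by simp
  then have "|X| <o order_on J" using assms ordLess_ordLeq_trans by blast
  then obtain j where j: "j \<in> J" "|X| =o Restr (order_on J) (underS (order_on J) j)"
    using ordLess_iff_ordIso_Restr[OF Well_order_order_on card_of_Well_order] by auto
  have "|X| \<le>o |Field (Restr (order_on J) (underS (order_on J) j))|"
    using card_of_mono2[OF ordIso_imp_ordLeq[OF j(2)]] by (simp add: Field_card_of)
  moreover have "Field (Restr (order_on J) (underS (order_on J) j)) \<subseteq> {..<j}"
    by (auto simp: Field_def underS_order_on[OF j(1)])
  ultimately have "|X| \<le>o |{..<j}|" using card_of_mono1 ordLeq_transitive by blast
  then show thesis using that j(1) by blast
qed

text \<open>A stand-in for the initial ordinal of \<open>|A|\<close>. The given order need not be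
  short on \<open>A\<close>, so the cardinal order of \<open>A\<close> is embedded into the order of
  the whole type; the image is an initial segment whose proper segments are smaller than
  \<open>A\<close>. It supplies both the stages and the ranks.\<close>

lemma initial_copy:
  fixes A :: "'a set"
  obtains f where "inj_on f A" "\<And>j i. j \<in> f ` A \<Longrightarrow> i < j \<Longrightarrow> i \<in> f ` A"
    "\<And>j. j \<in> f ` A \<Longrightarrow> |{..<j}| <o |A|"
proof -
  have "|UNIV :: 'a set| \<le>o order_on UNIV"
    using card_of_least[of UNIV "order_on UNIV"] Well_order_order_on[of UNIV] by simp
  moreover have "|A| \<le>o |UNIV :: 'a set|" by (rule card_of_mono1[OF subset_UNIV])
  ultimately have "|A| \<le>o order_on UNIV" using ordLeq_transitive by blast
  then obtain f where f: "embed |A| (order_on UNIV) f" unfolding ordLeq_def by blast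
  have bij: "bij_betw f (underS |A| a) {..<f a}" if "a \<in> A" for a
    using embed_underS[OF card_of_Well_order f, of a] that underS_order_on[of "f a" UNIV]
    by (simp add: Field_card_of)
  show thesis
  proof (rule that[of f])
    show "inj_on f A"
      using embed_inj_on[OF card_of_Well_order f] by (simp add: Field_card_of)
    fix j assume "j \<in> f ` A"
    then obtain a where a: "a \<in> A" "j = f a" by blast
    show "i \<in> f ` A" if "i < j" for i
    proof -
      have "i \<in> f ` underS |A| a" using bij[OF a(1)] that a(2) by (simp add: bij_betw_def)
      moreover have "underS |A| a \<subseteq> A"
        using Field_card_of[of A] by (auto simp: underS_def Field_def)
      ultimately show ?thesis by blast
    qed
    have "|{..<j}| =o |underS |A| a|"
      using bij[OF a(1)] card_of_ordIsoI ordIso_symmetric a(2) by blast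
    moreover have "|underS |A| a| <o |A|"
      using card_of_underS[OF card_of_Card_order] a(1) by (simp add: Field_card_of)
    ultimately show "|{..<j}| <o |A|" using ordIso_ordLess_trans by blast
  qed
qed

text \<open>Needed to pass from order types, of which \<open>nowhere_stationary\<close> speaks, to
  cardinalities of segments, of which the construction speaks.\<close>

lemma Card_order_if_initial:
  assumes wo: "Well_order p" and init: "\<And>a. a \<in> Field p \<Longrightarrow> |underS p a| <o |Field p|"
  shows "Card_order p"
  unfolding Card_order_iff_Restr_underS[OF wo]
proof
  fix a assume a: "a \<in> Field p"
  let ?q = "Restr p (underS p a)"
  have woq: "Well_order ?q" using Well_order_Restr[OF wo] .
  show "?q <o |Field p|"
  proof (rule ccontr)
    assume "\<not> ?thesis"
    then have "|Field p| \<le>o ?q" using ordLess_or_ordLeq[OF woq card_of_Well_order] by blast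
    then have "|Field p| \<le>o |Field ?q|" using card_of_mono2[of "|Field p|" ?q] by (simp add: Field_card_of)
    also have "|Field ?q| \<le>o |underS p a|" by (simp add: card_of_mono1 Field_Restr_subset)
    also have "|underS p a| <o |Field p|" using init[OF a] .
    finally show False using ordLess_irreflexive by blast
  qed
qed

text \<open>The three cases are: \<open>J\<close> has cofinality \<open>\<omega>\<close>; \<open>J\<close> is a copy of an ordinal to which
  \<^const>\<open>nowhere_stationary\<close> applies; \<open>J\<close> exceeds all members of \<open>S\<close>.\<close>

lemma unbounded_set_with_limits_avoiding:
  fixes S :: "'b rel set"
  assumes ns: "nowhere_stationary S" and cS: "cardinals S"
    and inf: "infinite J" and down: "\<And>j i. j \<in> J \<Longrightarrow> i < j \<Longrightarrow> i \<in> J"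
    and card: "\<And>j. j \<in> J \<Longrightarrow> |{..<j}| <o |J|"
  obtains C where "C \<subseteq> J" "\<And>j. j \<in> J \<Longrightarrow> \<exists>c\<in>C. j < c"
    "\<forall>s\<in>J. {..<s} \<noteq> {} \<longrightarrow> (\<forall>z<s. \<exists>b\<in>C. z < b \<and> b < s) \<longrightarrow>
      (\<forall>z<s. |{..<z}| <o |{..<s}| ) \<longrightarrow> (\<forall>\<kappa>\<in>S. \<not> |{..<s}| =o \<kappa>)"
proof -
  have no_max: "\<exists>k\<in>J. j < k" if j: "j \<in> J" for j
  proof (rule ccontr)
    assume "\<not> ?thesis"
    then have "J \<subseteq> insert j {..<j}" by force
    then have inf': "infinite {..<j}" using inf finite_subset by blast
    have "|J| \<le>o |insert j {..<j}|" using \<open>J \<subseteq> insert j {..<j}\<close> by (rule card_of_mono1)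
    also have "|insert j {..<j}| \<le>o |{..<j}|"
      using infinite_imp_bij_betw2[OF inf', of j] card_of_ordIsoI ordIso_imp_ordLeq ordIso_symmetric
      by (metis (no_types, lifting) Un_insert_right sup_bot_right)
    also have "|{..<j}| <o |J|" using card[OF j] .
    finally show False using ordLess_irreflexive by blast
  qed
  consider (countable) K where "K \<subseteq> J" "countable K" "\<And>j. j \<in> J \<Longrightarrow> \<exists>k\<in>K. j \<le> k"
    | (regular) "\<And>K. K \<subseteq> J \<Longrightarrow> (\<And>j. j \<in> J \<Longrightarrow> \<exists>k\<in>K. j \<le> k) \<Longrightarrow> uncountable K" "|J| \<le>o |UNIV :: 'b set|"
    | (big) "|UNIV :: 'b set| <o |J|"
    using ordLess_or_ordLeq[OF card_of_Well_order card_of_Well_order, of "UNIV :: 'b set" J] by blast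
  then show thesis
  proof cases
    case countable
    have "J \<noteq> {}" using inf by auto
    then have "K \<noteq> {}" using countable(3) by blast
    define k where "k = from_nat_into K"
    have range_k: "range k = K" using range_from_nat_into[OF \<open>K \<noteq> {}\<close> countable(2)] by (simp add: k_def)
    \<comment> \<open>Only the records of the enumeration are kept. They are still unbounded, but
      finitely many of them lie below any given \<open>s\<close> in \<open>J\<close>, so
      \<open>C\<close> has no limit point in \<open>J\<close>.\<close>
    define C where "C = {k n | n. \<forall>m<n. k m < k n}"
    show thesis
    proof (rule that[of C])
      show "C \<subseteq> J" using range_k countable(1) by (auto simp: C_def)
      fix j assume "j \<in> J"
      then obtain j' where "j' \<in> J" "j < j'" using no_max by blast
      then obtain n where "j' \<le> k n" using countable(3) range_k by blast
      then have "j < k n" using \<open>j < j'\<close> by simp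
      then obtain n where n: "j < k n" "\<forall>m. j < k m \<longrightarrow> n \<le> m"
        using ex_has_least_nat[of "\<lambda>n. j < k n" n "\<lambda>n. n"] by blast
      have "k m < k n" if "m < n" for m
      proof -
        have "\<not> n \<le> m" using that by simp
        then have "k m \<le> j" using n(2) not_less by blast
        then show ?thesis using n(1) by simp
      qed
      then show "\<exists>c\<in>C. j < c" using n(1) unfolding C_def by blast
    next
      show "\<forall>s\<in>J. {..<s} \<noteq> {} \<longrightarrow> (\<forall>z<s. \<exists>b\<in>C. z < b \<and> b < s) \<longrightarrow>
      (\<forall>z<s. |{..<z}| <o |{..<s}| ) \<longrightarrow> (\<forall>\<kappa>\<in>S. \<not> |{..<s}| =o \<kappa>)"
      proof (intro ballI impI)
        fix s and \<kappa> :: "'b rel"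
        assume s0: "s \<in> J" "{..<s} \<noteq> {}" "\<forall>z<s. \<exists>b\<in>C. z < b \<and> b < s"
          "\<forall>z<s. |{..<z}| <o |{..<s}|" and \<kappa>: "\<kappa> \<in> S"
        then have s: "s \<in> J" "{..<s} \<noteq> {}" "\<And>z. z < s \<Longrightarrow> \<exists>b\<in>C. z < b \<and> b < s"
          "\<And>z. z < s \<Longrightarrow> |{..<z}| <o |{..<s}|" by simp_all
        obtain n where n: "s \<le> k n" using countable(3)[OF s(1)] range_k by blast
        let ?F = "{b\<in>C. b < s}"
        have "?F \<subseteq> k ` {..<n}"
        proof
          fix b assume "b \<in> ?F"
          then obtain m where m: "b = k m" "\<forall>m'<m. k m' < k m" "k m < s" by (auto simp: C_def)
          have "m < n"
          proof (rule ccontr)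
            assume "\<not> m < n"
            then have "n < m \<or> n = m" by linarith
            then have "k n \<le> k m" using m(2) by auto
            then show False using n m(3) by simp
          qed
          then show "b \<in> k ` {..<n}" using m(1) by blast
        qed
        then have "finite ?F" using finite_subset by blast
        moreover have "infinite ?F"
        proof (rule infinite_growing)
          show "?F \<noteq> {}" using s(2,3) by blast
          show "\<exists>y\<in>?F. x < y" if "x \<in> ?F" for x using s(3)[of x] that by blast
        qed
        ultimately show "\<not> |{..<s}| =o \<kappa>" by contradiction
      qed
    qed
  next
    case regular
    obtain h :: "'a \<Rightarrow> 'b" where h: "inj_on h J" using regular(2) card_of_ordLeq[of J "UNIV :: 'b set"] by auto
    \<comment> \<open>\<open>J\<close> is copied to the type of \<open>S\<close>, since
      \<open>nowhere_stationary\<close> quantifies over well-orders on that type. A club of the copy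
      that avoids \<open>S\<close> is then pulled back.\<close>
    define \<beta> where "\<beta> = dir_image (order_on J) h"
    have wo\<beta>: "Well_order \<beta>" unfolding \<beta>_def using h Well_order_dir_image[OF Well_order_order_on] by simp
    have F\<beta>: "Field \<beta> = h ` J" unfolding \<beta>_def using dir_image_Field[of "order_on J" h] by simp
    have \<beta>_iff: "(h x, h y) \<in> \<beta> \<longleftrightarrow> x \<le> y" if "x \<in> J" "y \<in> J" for x y
      using that h by (auto simp: \<beta>_def dir_image_def order_on_def inj_on_def)
    have under\<beta>: "underS \<beta> (h s) = h ` {..<s}" if s: "s \<in> J" for s
    proof
      show "underS \<beta> (h s) \<subseteq> h ` {..<s}"
      proof
        fix b assume b: "b \<in> underS \<beta> (h s)"
        then have "b \<in> Field \<beta>" by (auto simp: underS_def Field_def)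
        then obtain z where z: "z \<in> J" "b = h z" using F\<beta> by blast
        then show "b \<in> h ` {..<s}" using b \<beta>_iff[OF z(1) s] by (auto simp: underS_def less_le)
      qed
      show "h ` {..<s} \<subseteq> underS \<beta> (h s)"
      proof
        fix b assume "b \<in> h ` {..<s}"
        then obtain z where z: "z < s" "b = h z" by blast
        then have "z \<in> J" using down s by blast
        moreover from this have "h z \<noteq> h s" using z(1) s h by (auto dest: inj_onD)
        ultimately show "b \<in> underS \<beta> (h s)" using \<beta>_iff[OF _ s] z by (auto simp: underS_def)
      qed
    qed
    have "natLeq <o cf \<beta>"
      unfolding natLeq_less_cf_iff[OF wo\<beta>]
    proof (intro allI impI)
      fix K assume K: "unbounded_in \<beta> K"
      let ?K = "{x\<in>J. h x \<in> K}"
      have "\<exists>k\<in>?K. j \<le> k" if j: "j \<in> J" for j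
      proof -
        have "\<exists>y\<in>K. (h j, y) \<in> \<beta>" "K \<subseteq> h ` J" using K j unfolding unbounded_in_def F\<beta> by blast+
        then obtain k where "k \<in> J" "h k \<in> K" "(h j, h k) \<in> \<beta>" by blast
        then show ?thesis using \<beta>_iff[OF j] by blast
      qed
      then have "uncountable ?K" using regular(1)[of ?K] by blast
      moreover have "countable ?K" if "countable K"
        by (rule countable_image_inj_on[of h]) (use that h in \<open>auto intro: countable_subset[of _ K] inj_on_subset\<close>)
      ultimately have "uncountable K" by blast
      then have "\<not> |K| \<le>o natLeq" using countable_iff_ordLeq_natLeq by blast
      then show "natLeq <o |K|"
        using not_ordLeq_iff_ordLess[OF natLeq_Well_order card_of_Well_order] by blast
    qed
    then have "\<not> stationary_in \<beta> (ordinals_below S \<beta>)"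
      using ns wo\<beta> unfolding nowhere_stationary_def by blast
    moreover have "ordinals_below S \<beta> \<subseteq> Field \<beta>" unfolding ordinals_below_def by blast
    ultimately obtain D where D: "club_in \<beta> D" "ordinals_below S \<beta> \<inter> D = {}"
      unfolding stationary_in_def by blast
    have D_sub: "D \<subseteq> h ` J" and D_unb: "\<And>x. x \<in> h ` J \<Longrightarrow> \<exists>y\<in>D. (x, y) \<in> \<beta>"
      and D_closed: "\<And>x. x \<in> h ` J \<Longrightarrow> underS \<beta> x \<noteq> {} \<Longrightarrow> cofinal (D \<inter> underS \<beta> x) (seg \<beta> x) \<Longrightarrow> x \<in> D"
      using D(1) unfolding club_in_def closed_in_ordinal_def unbounded_in_def F\<beta> by blast+
    define C where "C = {x\<in>J. h x \<in> D}"
    show thesis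
    proof (rule that[of C])
      show "C \<subseteq> J" by (auto simp: C_def)
      fix j assume "j \<in> J"
      then obtain k where k: "k \<in> J" "j < k" using no_max by blast
      then obtain y where y: "y \<in> D" "(h k, y) \<in> \<beta>" using D_unb by blast
      then obtain c where c: "c \<in> J" "y = h c" using D_sub by blast
      then have "k \<le> c" using \<beta>_iff[OF k(1) c(1)] y(2) by blast
      then show "\<exists>c\<in>C. j < c" using c y(1) k(2) unfolding C_def by force
    next
      show "\<forall>s\<in>J. {..<s} \<noteq> {} \<longrightarrow> (\<forall>z<s. \<exists>b\<in>C. z < b \<and> b < s) \<longrightarrow>
      (\<forall>z<s. |{..<z}| <o |{..<s}| ) \<longrightarrow> (\<forall>\<kappa>\<in>S. \<not> |{..<s}| =o \<kappa>)"
      proof (intro ballI impI)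
        fix s and \<kappa> :: "'b rel"
        assume s0: "s \<in> J" "{..<s} \<noteq> {}" "\<forall>z<s. \<exists>b\<in>C. z < b \<and> b < s"
          "\<forall>z<s. |{..<z}| <o |{..<s}|" and \<kappa>: "\<kappa> \<in> S"
        then have s: "s \<in> J" "{..<s} \<noteq> {}" "\<And>z. z < s \<Longrightarrow> \<exists>b\<in>C. z < b \<and> b < s"
          "\<And>z. z < s \<Longrightarrow> |{..<z}| <o |{..<s}|" by simp_all
        let ?p = "seg \<beta> (h s)"
        have wop: "Well_order ?p" unfolding seg_def using Well_order_Restr[OF wo\<beta>] .
        have hs: "h s \<in> Field \<beta>" using s(1) F\<beta> by blast
        have "Refl \<beta>" using wo\<beta> by (simp add: well_order_on_def linear_order_on_def
              partial_order_on_def preorder_on_def)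
        moreover have "h ` {..<s} \<subseteq> Field \<beta>" using F\<beta> down s(1) by blast
        ultimately have Fp: "Field ?p = h ` {..<s}"
          unfolding seg_def under\<beta>[OF s(1)] by (rule Refl_Field_Restr2)
        have "cofinal (D \<inter> underS \<beta> (h s)) ?p"
          unfolding cofinal_def
        proof
          fix a assume "a \<in> Field ?p"
          then obtain z where z: "z < s" "a = h z" using Fp by blast
          obtain b where b: "b \<in> C" "z < b" "b < s" using s(3)[OF z(1)] by blast
          have J: "z \<in> J" "b \<in> J" using z(1) b(3) down s(1) by blast+
          have "h b \<in> D \<inter> underS \<beta> (h s)" using b under\<beta>[OF s(1)] by (auto simp: C_def)
          moreover have "a \<noteq> h b" using z(2) J b(2) h by (auto dest: inj_onD)
          moreover have "(a, h b) \<in> ?p"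
            using \<beta>_iff[OF J] b under\<beta>[OF s(1)] z unfolding seg_def by (auto simp: less_imp_le)
          ultimately show "\<exists>b\<in>D \<inter> underS \<beta> (h s). a \<noteq> b \<and> (a, b) \<in> ?p" by blast
        qed
        moreover have "underS \<beta> (h s) \<noteq> {}" using under\<beta>[OF s(1)] s(2) by simp
        ultimately have "h s \<in> D" using D_closed[of "h s"] s(1) by blast
        then have not: "\<not> ?p =o \<kappa>" using D(2) \<kappa> hs unfolding ordinals_below_def by blast
        have inj: "inj_on h {..<s}" by (rule inj_on_subset[OF h]) (use down s(1) in blast)
        have iso: "|Field ?p| =o |{..<s}|"
          unfolding Fp using inj card_of_ordIsoI ordIso_symmetric inj_on_imp_bij_betw by metis
        \<comment> \<open>So far only the order type of the segment is known to avoid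
          \<open>S\<close>. As every proper segment of \<open>{..<s}\<close> is smaller, that order
          type is a cardinal and determined by the size of \<open>{..<s}\<close>.\<close>
        have "Card_order ?p"
        proof (rule Card_order_if_initial[OF wop])
          fix a assume "a \<in> Field ?p"
          then obtain z where z: "z < s" "a = h z" using Fp by blast
          have "underS ?p a \<subseteq> underS \<beta> a" unfolding seg_def underS_def by blast
          also have "underS \<beta> a = h ` {..<z}" using under\<beta> z down s(1) by blast
          finally have "|underS ?p a| \<le>o |{..<z}|"
            using card_of_mono1 card_of_image ordLeq_transitive by metis
          also have "|{..<z}| <o |{..<s}|" using s(4) z(1) by blast
          also have "|{..<s}| =o |Field ?p|" using iso ordIso_symmetric by blast
          finally show "|underS ?p a| <o |Field ?p|" .
        qed
        then have "?p =o |{..<s}|"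
          using card_of_Field_ordIso iso ordIso_symmetric ordIso_transitive by blast
        then show "\<not> |{..<s}| =o \<kappa>" using not ordIso_transitive by blast
      qed
    qed
  next
    case big
    \<comment> \<open>A limit \<open>s\<close> of this set, if initial, has more predecessors than
      the type of \<open>S\<close> has elements, hence more than any member of \<open>S\<close> can
      have.\<close>
    define C where "C = {c\<in>J. |UNIV :: 'b set| \<le>o |{..<c}| }"
    obtain c0 where c0: "c0 \<in> J" "|UNIV :: 'b set| \<le>o |{..<c0}|" using exists_ordLeq_lessThan[OF big] .
    show thesis
    proof (rule that[of C])
      show "C \<subseteq> J" by (auto simp: C_def)
      fix j assume j: "j \<in> J"
      then have "max j c0 \<in> J" using c0(1) by (simp add: max_def)
      then obtain c where c: "c \<in> J" "max j c0 < c" using no_max by blast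
      then have "{..<c0} \<subseteq> {..<c}" by auto
      then have "|{..<c0}| \<le>o |{..<c}|" by (rule card_of_mono1)
      then have "c \<in> C" using c(1) c0(2) ordLeq_transitive unfolding C_def by blast
      then show "\<exists>c\<in>C. j < c" using c(2) by auto
    next
      show "\<forall>s\<in>J. {..<s} \<noteq> {} \<longrightarrow> (\<forall>z<s. \<exists>b\<in>C. z < b \<and> b < s) \<longrightarrow>
      (\<forall>z<s. |{..<z}| <o |{..<s}| ) \<longrightarrow> (\<forall>\<kappa>\<in>S. \<not> |{..<s}| =o \<kappa>)"
      proof (intro ballI impI)
        fix s and \<kappa> :: "'b rel"
        assume s0: "s \<in> J" "{..<s} \<noteq> {}" "\<forall>z<s. \<exists>b\<in>C. z < b \<and> b < s"
          "\<forall>z<s. |{..<z}| <o |{..<s}|" and \<kappa>: "\<kappa> \<in> S"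
        then have s: "s \<in> J" "{..<s} \<noteq> {}" "\<And>z. z < s \<Longrightarrow> \<exists>b\<in>C. z < b \<and> b < s"
          "\<And>z. z < s \<Longrightarrow> |{..<z}| <o |{..<s}|" by simp_all
        show "\<not> |{..<s}| =o \<kappa>"
        proof
          assume iso: "|{..<s}| =o \<kappa>"
          obtain b where b: "b \<in> C" "b < s" using s(2,3) by blast
          have "|UNIV :: 'b set| \<le>o |{..<b}|" using b(1) by (simp add: C_def)
          also have "|{..<b}| <o |{..<s}|" using s(4) b(2) by blast
          also have "|{..<s}| =o \<kappa>" by (fact iso)
          also have "\<kappa> =o |Field \<kappa>|"
            using cS \<kappa> card_of_Field_ordIso ordIso_symmetric unfolding cardinals_def by blast
          also have "|Field \<kappa>| \<le>o |UNIV :: 'b set|" by (rule card_of_mono1[OF subset_UNIV])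
          finally show False using ordLess_irreflexive by blast
        qed
      qed
    qed
  qed
qed

end

section \<open>Closures and filtrations\<close>

lemma card_of_finite_subsets:
  assumes "infinite A"
  shows "|{F. finite F \<and> F \<subseteq> A}| \<le>o |A|"
proof -
  let ?L = "\<lambda>n. {F. finite F \<and> F \<subseteq> A \<and> card F = n}"
  have level: "|?L n| \<le>o |A|" for n
  proof (induction n)
    case 0
    have "?L 0 = {{}}" by auto
    then show ?case using assms finite_ordLess ordLess_imp_ordLeq by (metis finite.emptyI finite.insertI)
  next
    case (Suc n)
    have "?L (Suc n) \<subseteq> (\<Union>a\<in>A. insert a ` ?L n)"
    proof
      fix F assume "F \<in> ?L (Suc n)"
      then obtain a F' where "F = insert a F'" "a \<notin> F'" "card F' = n" "finite F" "F \<subseteq> A"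
        by (auto simp: card_Suc_eq)
      then show "F \<in> (\<Union>a\<in>A. insert a ` ?L n)" by auto
    qed
    then have "|?L (Suc n)| \<le>o |\<Union>a\<in>A. insert a ` ?L n|" by (rule card_of_mono1)
    also have "|\<Union>a\<in>A. insert a ` ?L n| \<le>o |A|"
    proof (rule card_of_UNION_ordLeq_infinite[OF assms])
      show "|A| \<le>o |A|" by (rule ordLeq_reflexive[OF card_of_Well_order])
      show "\<forall>a\<in>A. |insert a ` ?L n| \<le>o |A|" using card_of_image Suc.IH ordLeq_transitive by blast
    qed
    finally show ?case .
  qed
  have "{F. finite F \<and> F \<subseteq> A} = (\<Union>n. ?L n)" by auto
  moreover have "|\<Union>n. ?L n| \<le>o |A|"
    by (rule card_of_UNION_ordLeq_infinite[OF assms]) (use level assms infinite_iff_card_of_nat in auto)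
  ultimately show ?thesis by simp
qed

lemma finite_subset_directed_UN:
  assumes "finite F" "F \<subseteq> (\<Union>i\<in>I. B i)" "I \<noteq> {}"
    and dir: "\<And>i j. i \<in> I \<Longrightarrow> j \<in> I \<Longrightarrow> \<exists>k\<in>I. B i \<subseteq> B k \<and> B j \<subseteq> B k"
  shows "\<exists>k\<in>I. F \<subseteq> B k"
  using assms(1,2)
proof (induction F rule: finite_induct)
  case empty
  then show ?case using assms(3) by blast
next
  case (insert x F)
  then obtain i j where ij: "i \<in> I" "F \<subseteq> B i" "j \<in> I" "x \<in> B j" by auto
  then obtain k where "k \<in> I" "B i \<subseteq> B k" "B j \<subseteq> B k" using dir[of i j] by blast
  then show ?case using ij by blast
qed

lemma obtain_subset_of_card:
  assumes "\<not> (finite Z \<and> card Z < r)"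
  obtains F where "F \<subseteq> Z" "finite F" "card F = r"
proof (cases "finite Z")
  case True
  then show ?thesis using assms that obtain_subset_with_card_n[of r Z] by (auto simp: not_less)
next
  case False
  then show ?thesis using infinite_arbitrarily_large[of Z r] that by blast
qed

text \<open>Since \<open>r\<close> points determine an edge, an infinite \<open>Z\<close> captures
  at most as many edges as it has finite subsets, that is, at most \<open>|Z|\<close>. Adding these
  edges does not increase the size as long as they are no larger than \<open>X\<close>. Countably
  many rounds suffice, because \<open>r\<close> points of the union lie in a single round.\<close>

lemma exists_closed_superset:
  assumes ad: "almost_disjoint r \<G>" and inf: "infinite X"
  obtains B where "X \<subseteq> B" "|B| \<le>o |X|"
    "\<And>E. E \<in> \<G> \<Longrightarrow> |E| \<le>o |X| \<Longrightarrow> E \<subseteq> B \<or> finite (E \<inter> B) \<and> card (E \<inter> B) < r"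
proof -
  define new where "new Z = {E\<in>\<G>. |E| \<le>o |X| \<and> (\<exists>F. F \<subseteq> Z \<and> F \<subseteq> E \<and> finite F \<and> card F = r)}" for Z
  define B where "B n = ((\<lambda>Z. Z \<union> \<Union>(new Z)) ^^ n) X" for n
  have B_Suc: "B (Suc n) = B n \<union> \<Union>(new (B n))" for n by (simp add: B_def)
  have mono: "B m \<subseteq> B n" if "m \<le> n" for m n
    using that by (rule lift_Suc_mono_le[rotated]) (auto simp: B_Suc)
  have new_card: "|new Z| \<le>o |X|" if Z: "|Z| \<le>o |X|" "infinite Z" for Z
  proof -
    have "\<forall>E\<in>new Z. \<exists>F. F \<subseteq> Z \<and> F \<subseteq> E \<and> finite F \<and> card F = r" by (simp add: new_def)
    then obtain \<phi> where \<phi>: "\<And>E. E \<in> new Z \<Longrightarrow> \<phi> E \<subseteq> Z \<and> \<phi> E \<subseteq> E \<and> finite (\<phi> E) \<and> card (\<phi> E) = r"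
      by metis
    have "inj_on \<phi> (new Z)"
    proof (rule inj_onI, rule ccontr)
      fix E E' assume E: "E \<in> new Z" "E' \<in> new Z" "\<phi> E = \<phi> E'" "E \<noteq> E'"
      have "E \<in> \<G>" "E' \<in> \<G>" using E(1,2) by (auto simp: new_def)
      then have *: "finite (E \<inter> E') \<and> card (E \<inter> E') < r" using almost_disjointD[OF ad] E(4) by blast
      have "\<phi> E \<subseteq> E \<inter> E'" using \<phi>[OF E(1)] \<phi>[OF E(2)] E(3) by auto
      then have "card (\<phi> E) \<le> card (E \<inter> E')" using * card_mono by blast
      then show False using \<phi>[OF E(1)] * by linarith
    qed
    moreover have "\<phi> ` new Z \<subseteq> {F. finite F \<and> F \<subseteq> Z}" using \<phi> by auto
    ultimately have "|new Z| \<le>o |{F. finite F \<and> F \<subseteq> Z}|" using card_of_ordLeq by blast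
    also have "|{F. finite F \<and> F \<subseteq> Z}| \<le>o |Z|" by (rule card_of_finite_subsets[OF Z(2)])
    also have "|Z| \<le>o |X|" by (rule Z(1))
    finally show ?thesis .
  qed
  have B_card: "X \<subseteq> B n \<and> |B n| \<le>o |X|" for n
  proof (induction n)
    case 0
    then show ?case by (simp add: B_def ordLeq_reflexive[OF card_of_Well_order])
  next
    case (Suc n)
    have "infinite (B n)" using Suc inf finite_subset by blast
    have "|\<Union>E\<in>new (B n). E| \<le>o |X|"
    proof (rule card_of_UNION_ordLeq_infinite[OF inf])
      show "|new (B n)| \<le>o |X|" using new_card Suc \<open>infinite (B n)\<close> by blast
      show "\<forall>E\<in>new (B n). |E| \<le>o |X|" by (simp add: new_def)
    qed
    then have "|\<Union>(new (B n))| \<le>o |X|" by simp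
    then have "|B n \<union> \<Union>(new (B n))| \<le>o |X|"
      using card_of_Un_ordLeq_infinite_Field[OF _ _ _ card_of_Card_order, of X "B n" "\<Union>(new (B n))"] Suc inf
      by (simp add: Field_card_of)
    then show ?case using Suc unfolding B_Suc by blast
  qed
  show thesis
  proof (rule that[of "\<Union>n. B n"])
    show "X \<subseteq> (\<Union>n. B n)" using B_card[of 0] by blast
    show "|\<Union>n. B n| \<le>o |X|"
      by (rule card_of_UNION_ordLeq_infinite[OF inf]) (use B_card inf infinite_iff_card_of_nat in auto)
    fix E assume E: "E \<in> \<G>" "|E| \<le>o |X|"
    show "E \<subseteq> (\<Union>n. B n) \<or> finite (E \<inter> (\<Union>n. B n)) \<and> card (E \<inter> (\<Union>n. B n)) < r"
    proof (rule disjCI)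
      assume "\<not> (finite (E \<inter> (\<Union>n. B n)) \<and> card (E \<inter> (\<Union>n. B n)) < r)"
      then obtain F where F: "F \<subseteq> E \<inter> (\<Union>n. B n)" "finite F" "card F = r"
        by (rule obtain_subset_of_card)
      have "\<exists>n\<in>UNIV. F \<subseteq> B n"
      proof (rule finite_subset_directed_UN[OF F(2)])
        show "\<exists>k\<in>UNIV. B i \<subseteq> B k \<and> B j \<subseteq> B k" for i j
          using mono[of i "max i j"] mono[of j "max i j"] by auto
      qed (use F(1) in auto)
      then obtain n where "F \<subseteq> B n" by blast
      then have "E \<in> new (B n)" using E F unfolding new_def by blast
      then have "E \<subseteq> B (Suc n)" unfolding B_Suc by blast
      then show "E \<subseteq> (\<Union>n. B n)" by blast
    qed
  qed
qed

context wellorder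
begin

text \<open>
  The sets \<open>B c\<close> are closures, increasing in \<open>c\<close>. An edge not larger than some earlier stage has
  fewer than \<open>r\<close> points in the earlier stages. Any other edge is larger than all earlier stages, so
  their union could only be too large if the size of the edge were a limit point of \<open>C\<close>; the limit
  points of \<open>C\<close> that are cardinals do not belong to \<open>S\<close>.
\<close>

lemma filtration:
  fixes S :: "'b rel set" and A :: "'a set"
  assumes ns: "nowhere_stationary S" and cS: "cardinals S"
    and unc: "uncountable A" and sub: "\<G> \<subseteq> Pow A" and ne: "{} \<notin> \<G>"
    and sized: "sized S \<G>" and ad: "almost_disjoint r \<G>"
  obtains C :: "'a set" and B where "\<And>c. c \<in> C \<Longrightarrow> |B c| <o |A|"
    "\<And>E. E \<in> \<G> \<Longrightarrow> |E| <o |A| \<Longrightarrow> \<exists>c\<in>C. E \<subseteq> B c"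
    "\<And>c E. c \<in> C \<Longrightarrow> E \<in> \<G> \<Longrightarrow> E \<subseteq> B c \<Longrightarrow> (\<And>b. b \<in> C \<Longrightarrow> b < c \<Longrightarrow> \<not> E \<subseteq> B b) \<Longrightarrow>
      E - (\<Union>b\<in>{b\<in>C. b < c}. B b) \<noteq> {} \<and>
      (finite E \<or> |E \<inter> (\<Union>b\<in>{b\<in>C. b < c}. B b)| <o |E| )"
proof -
  obtain f where f: "inj_on f A" and down: "\<And>j i. j \<in> f ` A \<Longrightarrow> i < j \<Longrightarrow> i \<in> f ` A"
    and card_under: "\<And>j. j \<in> f ` A \<Longrightarrow> |{..<j}| <o |A|"
    using initial_copy[of A] by blast
  define J where "J = f ` A"
  have J_iso: "|J| =o |A|"
    unfolding J_def using f card_of_ordIsoI ordIso_symmetric inj_on_imp_bij_betw by metis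
  have under_J: "|{..<j}| <o |J|" if "j \<in> J" for j
    using card_under that J_iso ordIso_symmetric ordLess_ordIso_trans unfolding J_def by blast
  have "infinite A" using unc countable_finite by blast
  then have "infinite J" using f by (simp add: J_def finite_image_iff)
  have "\<exists>C0\<subseteq>J. (\<forall>j\<in>J. \<exists>c\<in>C0. j < c) \<and> (\<forall>s\<in>J. {..<s} \<noteq> {} \<longrightarrow> (\<forall>z<s. \<exists>b\<in>C0. z < b \<and> b < s) \<longrightarrow>
      (\<forall>z<s. |{..<z}| <o |{..<s}| ) \<longrightarrow> (\<forall>\<kappa>\<in>S. \<not> |{..<s}| =o \<kappa>))"
  proof (rule unbounded_set_with_limits_avoiding[OF ns cS \<open>infinite J\<close> down[folded J_def] under_J])
    fix C0 assume "C0 \<subseteq> J" and 1: "\<And>j. j \<in> J \<Longrightarrow> \<exists>c\<in>C0. j < c"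
      and 2: "\<forall>s\<in>J. {..<s} \<noteq> {} \<longrightarrow> (\<forall>z<s. \<exists>b\<in>C0. z < b \<and> b < s) \<longrightarrow>
        (\<forall>z<s. |{..<z}| <o |{..<s}| ) \<longrightarrow> (\<forall>\<kappa>\<in>S. \<not> |{..<s}| =o \<kappa>)"
    have "\<forall>j\<in>J. \<exists>c\<in>C0. j < c" using 1 by simp
    with \<open>C0 \<subseteq> J\<close> 2 show ?thesis by (intro exI[of _ C0] conjI)
  qed
  then obtain C0 where C0: "C0 \<subseteq> J" "\<forall>j\<in>J. \<exists>c\<in>C0. j < c" "\<forall>s\<in>J. {..<s} \<noteq> {} \<longrightarrow>
      (\<forall>z<s. \<exists>b\<in>C0. z < b \<and> b < s) \<longrightarrow> (\<forall>z<s. |{..<z}| <o |{..<s}| ) \<longrightarrow> (\<forall>\<kappa>\<in>S. \<not> |{..<s}| =o \<kappa>)"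
    by (elim exE conjE)
  \<comment> \<open>Infinitely many predecessors make \<open>X c\<close> infinite, as the closure
    lemma demands; \<open>C\<close> stays unbounded because \<open>A\<close> is uncountable.\<close>
  define C where "C = {c\<in>C0. infinite {..<c}}"
  have C_J: "c \<in> J" if "c \<in> C" for c using that C0(1) by (auto simp: C_def)
  have C_unb: "\<exists>c\<in>C. j < c" if j: "j \<in> J" for j
  proof -
    have "|UNIV :: nat set| <o |A|"
    proof (rule ccontr)
      assume "\<not> ?thesis"
      then have "|A| \<le>o |UNIV :: nat set|"
        using ordLess_or_ordLeq[OF card_of_Well_order card_of_Well_order] by blast
      then have "countable A"
        unfolding countable_iff_ordLeq_natLeq using card_of_nat ordLeq_ordIso_trans by blast
      then show False using unc by blast
    qed
    then have "|UNIV :: nat set| <o |J|" using J_iso ordIso_symmetric ordLess_ordIso_trans by blast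
    then obtain i where i: "i \<in> J" "|UNIV :: nat set| \<le>o |{..<i}|" by (rule exists_ordLeq_lessThan)
    have "max i j \<in> J" using i(1) j by (simp add: max_def)
    then obtain c where c: "c \<in> C0" "max i j < c" using C0(2) by blast
    have "{..<i} \<subseteq> {..<c}" using c(2) by auto
    moreover have "infinite {..<i}" using i(2) infinite_iff_card_of_nat by blast
    ultimately have "infinite {..<c}" using finite_subset by blast
    then show ?thesis using c by (auto simp: C_def)
  qed
  define X where "X c = {a\<in>A. f a < c}" for c
  have X_mono: "X b \<subseteq> X c" if "b \<le> c" for b c using that by (auto simp: X_def)
  have X_iso: "|X c| =o |{..<c}|" if "c \<in> J" for c
  proof -
    have "f ` X c = {..<c}" using down that by (auto simp: X_def J_def)
    moreover have "inj_on f (X c)" using f by (rule inj_on_subset) (auto simp: X_def)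
    ultimately have "bij_betw f (X c) {..<c}" by (simp add: bij_betw_def)
    then show ?thesis by (rule card_of_ordIsoI)
  qed
  define closed where "closed c Z \<longleftrightarrow> X c \<subseteq> Z \<and>
    (\<forall>E\<in>\<G>. |E| \<le>o |{..<c}| \<longrightarrow> E \<subseteq> Z \<or> finite (E \<inter> Z) \<and> card (E \<inter> Z) < r)" for c Z
  \<comment> \<open>Intersecting all closed sets instead of choosing one makes \<open>B\<close>
    monotone without a recursion: whatever is closed for \<open>c\<close> is closed for every
    smaller index.\<close>
  define B where "B c = \<Inter>{Z. closed c Z}" for c
  have X_B: "X c \<subseteq> B c" for c by (auto simp: B_def closed_def)
  have B_closed: "E \<subseteq> B c \<or> finite (E \<inter> B c) \<and> card (E \<inter> B c) < r" if E: "E \<in> \<G>" "|E| \<le>o |{..<c}|" for E c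
  proof (cases "E \<subseteq> B c")
    case False
    then obtain Z where Z: "closed c Z" "\<not> E \<subseteq> Z" by (auto simp: B_def)
    then have *: "finite (E \<inter> Z)" "card (E \<inter> Z) < r" using E unfolding closed_def by blast+
    have "E \<inter> B c \<subseteq> E \<inter> Z" using Z(1) by (auto simp: B_def)
    then have "finite (E \<inter> B c)" "card (E \<inter> B c) \<le> card (E \<inter> Z)" using *(1) finite_subset card_mono by blast+
    then show ?thesis using *(2) by linarith
  qed simp
  have B_mono: "B b \<subseteq> B c" if "b \<le> c" for b c
  proof -
    have "{..<b} \<subseteq> {..<c}" using that by auto
    then have "|{..<b}| \<le>o |{..<c}|" by (rule card_of_mono1)
    then have "closed b Z" if "closed c Z" for Z
      using that X_mono[OF \<open>b \<le> c\<close>] ordLeq_transitive unfolding closed_def by blast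
    then show ?thesis by (auto simp: B_def)
  qed
  have B_card: "|B c| \<le>o |{..<c}|" if c: "c \<in> C" for c
  proof -
    have iso: "|X c| =o |{..<c}|" using X_iso C_J c by blast
    then have "infinite (X c)" using c card_of_ordIso_finite unfolding C_def by blast
    then obtain Z where Z: "X c \<subseteq> Z" "|Z| \<le>o |X c|"
      "\<And>E. E \<in> \<G> \<Longrightarrow> |E| \<le>o |X c| \<Longrightarrow> E \<subseteq> Z \<or> finite (E \<inter> Z) \<and> card (E \<inter> Z) < r"
      using exists_closed_superset[OF ad] by metis
    have "closed c Z"
      unfolding closed_def using Z(1,3) iso ordIso_symmetric ordLeq_ordIso_trans by blast
    then have "B c \<subseteq> Z" by (auto simp: B_def)
    then have "|B c| \<le>o |Z|" by (rule card_of_mono1)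
    then show ?thesis using Z(2) iso ordLeq_transitive ordLeq_ordIso_trans by blast
  qed
  have dir: "\<exists>k\<in>D. B i \<subseteq> B k \<and> B j \<subseteq> B k" if "i \<in> D" "j \<in> D" for i j D
  proof -
    have "max i j \<in> D" using that by (simp add: max_def)
    moreover have "B i \<subseteq> B (max i j)" "B j \<subseteq> B (max i j)" using B_mono by simp_all
    ultimately show ?thesis by blast
  qed
  have A_sub: "A \<subseteq> (\<Union>c\<in>C. B c)"
  proof
    fix a assume a: "a \<in> A"
    then obtain c where "c \<in> C" "f a < c" using C_unb[of "f a"] by (auto simp: J_def)
    then show "a \<in> (\<Union>c\<in>C. B c)" using a X_B[of c] by (auto simp: X_def)
  qed
  have "J \<noteq> {}" using \<open>infinite J\<close> by auto
  then have C_ne: "C \<noteq> {}" using C_unb by blast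
  show thesis
  proof (rule that[of C B])
    fix c assume c: "c \<in> C"
    have "|B c| \<le>o |{..<c}|" using B_card[OF c] .
    also have "|{..<c}| <o |A|" using card_under C_J[OF c] unfolding J_def .
    finally show "|B c| <o |A|" .
  next
    fix E assume E: "E \<in> \<G>" "|E| <o |A|"
    have E_sub: "E \<subseteq> (\<Union>c\<in>C. B c)" using E(1) sub A_sub by blast
    show "\<exists>c\<in>C. E \<subseteq> B c"
    proof (cases "finite E")
      case True
      then show ?thesis using E_sub C_ne dir by (rule finite_subset_directed_UN)
    next
      case False
      have "|E| <o |J|" using E(2) J_iso ordIso_symmetric ordLess_ordIso_trans by blast
      then obtain j where j: "j \<in> J" "|E| \<le>o |{..<j}|" by (rule exists_ordLeq_lessThan)
      obtain c1 where c1: "c1 \<in> C" "j < c1" using C_unb j(1) by blast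
      \<comment> \<open>Two conditions have to meet at one stage: \<open>E\<close> is not too large
        for it, from \<open>c1\<close> on, and \<open>r\<close> points of \<open>E\<close> belong to
        it, from \<open>c2\<close> on. Then closedness puts all of \<open>E\<close> into that
        stage.\<close>
      obtain F where F: "F \<subseteq> E" "finite F" "card F = r"
        using False by (auto intro: obtain_subset_of_card[of E r])
      have "F \<subseteq> (\<Union>c\<in>C. B c)" using F(1) E_sub by blast
      then have "\<exists>c\<in>C. F \<subseteq> B c" using F(2) C_ne dir by (auto intro: finite_subset_directed_UN)
      then obtain c2 where c2: "c2 \<in> C" "F \<subseteq> B c2" by blast
      let ?c = "max c1 c2"
      have "{..<j} \<subseteq> {..<?c}" using c1(2) by (auto simp: less_max_iff_disj)
      then have "|{..<j}| \<le>o |{..<?c}|" by (rule card_of_mono1)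
      then have Ec: "|E| \<le>o |{..<?c}|" using j(2) ordLeq_transitive by blast
      have "F \<subseteq> E \<inter> B ?c" using F(1) c2(2) B_mono[of c2 ?c] by auto
      then have "card F \<le> card (E \<inter> B ?c)" if "finite (E \<inter> B ?c)" using that card_mono by blast
      then have "E \<subseteq> B ?c" using B_closed[OF E(1) Ec] F(3) by auto
      moreover have "?c \<in> C" using c1(1) c2(1) by (simp add: max_def)
      ultimately show ?thesis by blast
    qed
  next
    fix c E assume c: "c \<in> C" and E: "E \<in> \<G>" "E \<subseteq> B c" and least: "\<And>b. b \<in> C \<Longrightarrow> b < c \<Longrightarrow> \<not> E \<subseteq> B b"
    let ?D = "{b\<in>C. b < c}"
    let ?U = "\<Union>b\<in>?D. B b"
    have "E \<noteq> {}" using E(1) ne by blast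
    consider (empty) "?D = {}" | (closed) b where "b \<in> ?D" "|E| \<le>o |{..<b}|"
      | (large) "?D \<noteq> {}" "\<And>b. b \<in> ?D \<Longrightarrow> |{..<b}| <o |E|"
      using ordLess_or_ordLeq[OF card_of_Well_order card_of_Well_order] by blast
    then show "E - ?U \<noteq> {} \<and> (finite E \<or> |E \<inter> ?U| <o |E| )"
    proof cases
      case empty
      then have "?U = {}" by blast
      then show ?thesis using \<open>E \<noteq> {}\<close> finite_ordLess[of "{}" E] by auto
    next
      case (closed b)
      have ne_D: "?D \<noteq> {}" using closed(1) by blast
      have no: False if F: "F \<subseteq> E \<inter> ?U" "finite F" "card F = r" for F
      proof -
        have "\<exists>k\<in>?D. F \<subseteq> B k"
          by (rule finite_subset_directed_UN[OF F(2) _ ne_D dir]) (use F(1) in auto)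
        then obtain k where k: "k \<in> ?D" "F \<subseteq> B k" by blast
        let ?m = "max b k"
        have m: "?m \<in> C" "?m < c" using closed(1) k(1) by (auto simp: max_def)
        have "{..<b} \<subseteq> {..<?m}" by (auto simp: less_max_iff_disj)
        then have "|{..<b}| \<le>o |{..<?m}|" by (rule card_of_mono1)
        then have "|E| \<le>o |{..<?m}|" using closed(2) ordLeq_transitive by blast
        moreover have "F \<subseteq> E \<inter> B ?m" using F(1) k(2) B_mono[of k ?m] by auto
        then have "card F \<le> card (E \<inter> B ?m)" if "finite (E \<inter> B ?m)" using that card_mono by blast
        ultimately have "E \<subseteq> B ?m" using B_closed[OF E(1)] F(3) by fastforce
        then show False using least m by blast
      qed
      have fin: "finite (E \<inter> ?U)" using no obtain_subset_of_card[of "E \<inter> ?U" r] by metis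
      have "\<not> E \<subseteq> ?U"
      proof
        assume "E \<subseteq> ?U"
        moreover from this fin have "finite E" by (simp add: Int_absorb2)
        ultimately have "\<exists>k\<in>?D. E \<subseteq> B k" using finite_subset_directed_UN[OF _ _ ne_D dir] by blast
        then show False using least by blast
      qed
      then show ?thesis using fin finite_ordLess by blast
    next
      case large
      have "infinite E"
      proof -
        obtain b where b: "b \<in> ?D" using large(1) by blast
        then have "infinite {..<b}" by (simp add: C_def)
        then show ?thesis using large(2)[OF b] card_of_ordLeq_finite ordLess_imp_ordLeq by blast
      qed
      have "|?U| <o |E|"
      proof (cases "\<exists>m\<in>?D. \<forall>b\<in>?D. b \<le> m")
        case True
        then obtain m where m: "m \<in> ?D" "\<forall>b\<in>?D. b \<le> m" by blast
        then have "?U \<subseteq> B m" using B_mono by blast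
        then have "|?U| \<le>o |B m|" by (rule card_of_mono1)
        also have "|B m| \<le>o |{..<m}|" using B_card m(1) by blast
        also have "|{..<m}| <o |E|" using large(2) m(1) by blast
        finally show ?thesis .
      next
        case False
        \<comment> \<open>\<open>C\<close> is not known to be closed, so the limit to inspect is the
          supremum of the earlier stages, which may lie below \<open>c\<close>. If \<open>?U\<close>
          were as large as \<open>E\<close>, then \<open>s\<close> would be an initial ordinal of
          the size of \<open>E\<close>, contrary to the choice of \<open>C0\<close>.\<close>
        define s where "s = (LEAST s. \<forall>b\<in>?D. b < s)"
        have s: "\<forall>b\<in>?D. b < s" unfolding s_def by (rule LeastI[of _ c]) simp
        have "s \<le> c" unfolding s_def by (rule Least_le) simp
        then have "s \<in> J" using C_J[OF c] down le_less unfolding J_def by metis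
        have lim: "\<exists>b\<in>?D. z < b \<and> b < s" if "z < s" for z
        proof -
          have "\<not> (\<forall>b\<in>?D. b < z)" using that not_less_Least unfolding s_def by blast
          then obtain b where "b \<in> ?D" "z \<le> b" by (auto simp: not_less)
          moreover obtain b' where "b' \<in> ?D" "b < b'" using False \<open>b \<in> ?D\<close> by (auto simp: not_le)
          ultimately show ?thesis using s le_less_trans by blast
        qed
        obtain b0 where b0: "b0 \<in> ?D" using large(1) by blast
        then have "{..<b0} \<subseteq> {..<s}" using s by auto
        then have inf_s: "infinite {..<s}" using b0 finite_subset unfolding C_def by blast
        show ?thesis
        proof (rule ccontr)
          assume "\<not> ?thesis"
          then have "|E| \<le>o |?U|"
            using ordLess_or_ordLeq[OF card_of_Well_order card_of_Well_order] by blast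
          also have "|?U| \<le>o |{..<s}|"
          proof (rule card_of_UNION_ordLeq_infinite[OF inf_s])
            show "|?D| \<le>o |{..<s}|" by (rule card_of_mono1) (use s in auto)
            show "\<forall>b\<in>?D. |B b| \<le>o |{..<s}|"
            proof
              fix b assume b: "b \<in> ?D"
              then have "{..<b} \<subseteq> {..<s}" using s by auto
              then have "|{..<b}| \<le>o |{..<s}|" by (rule card_of_mono1)
              then show "|B b| \<le>o |{..<s}|" using B_card b ordLeq_transitive by blast
            qed
          qed
          finally have le: "|E| \<le>o |{..<s}|" .
          have below: "|{..<z}| <o |E|" if z: "z < s" for z
          proof -
            obtain b where b: "b \<in> ?D" "z < b" using lim[OF z] by blast
            then have "{..<z} \<subseteq> {..<b}" by auto
            then have "|{..<z}| \<le>o |{..<b}|" by (rule card_of_mono1)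
            then show ?thesis using large(2)[OF b(1)] ordLeq_ordLess_trans by blast
          qed
          have "\<not> |E| <o |{..<s}|"
          proof
            assume "|E| <o |{..<s}|"
            then obtain z where "z \<in> {..<s}" "|E| \<le>o |{..<z}|" by (rule exists_ordLeq_lessThan)
            then show False using below[of z] not_ordLess_ordLeq by auto
          qed
          then have "|E| =o |{..<s}|" using le ordLeq_iff_ordLess_or_ordIso by blast
          moreover obtain \<kappa> where \<kappa>: "\<kappa> \<in> S" "|E| =o \<kappa>"
            using sized E(1) \<open>infinite E\<close> unfolding sized_def by blast
          ultimately have "|{..<s}| =o \<kappa>" using ordIso_symmetric ordIso_transitive by blast
          moreover have "\<not> |{..<s}| =o \<kappa>"
          proof -
            have 1: "{..<s} \<noteq> {}" using inf_s by auto
            have 2: "\<forall>z<s. \<exists>b\<in>C0. z < b \<and> b < s" using lim by (fastforce simp: C_def)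
            have 3: "\<forall>z<s. |{..<z}| <o |{..<s}|"
              using below le ordLess_ordLeq_trans by blast
            show ?thesis using bspec[OF C0(3) \<open>s \<in> J\<close>] 1 2 3 \<kappa>(1) by simp
          qed
          ultimately show False by blast
        qed
      qed
      moreover have "|E \<inter> ?U| \<le>o |?U|" by (rule card_of_mono1) blast
      ultimately have "|E \<inter> ?U| <o |E|" using ordLeq_ordLess_trans by blast
      moreover have "\<not> E \<subseteq> ?U"
      proof
        assume "E \<subseteq> ?U"
        then have "E \<inter> ?U = E" by (rule Int_absorb2)
        then show False using \<open>|E \<inter> ?U| <o |E|\<close> ordLess_irreflexive[of "|E|"] by simp
      qed
      ultimately show ?thesis by blast
    qed
  qed
qed


section \<open>Induction on the number of vertices\<close>

text \<open>
  The recursion runs over \<open>(0, c)\<close> for the stages \<open>c\<close> of the filtration, then over \<open>(1, i)\<close> for the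
  edges of size \<open>|A|\<close>, each being ranked by its index \<open>i\<close> while it waits to be hit.
\<close>

lemma solvable_uncountable:
  fixes S :: "'b rel set" and A :: "'a set"
  assumes ns: "nowhere_stationary S" and cS: "cardinals S" and unc: "uncountable A"
    and adm: "admissible S r A \<G> \<H> rk"
    and IH: "\<And>B \<G>' \<H>' rk'. |B| <o |A| \<Longrightarrow> admissible S r B \<G>' \<H>' rk' \<Longrightarrow> strongly_solvable \<G>' \<H>' rk'"
  shows "solvable \<G> \<H> rk"
proof -
  have sub: "\<G> \<subseteq> Pow A" and ne: "{} \<notin> \<G>" and sized: "sized S \<G>" and ad: "almost_disjoint r \<G>"
    and fin: "\<And>H E. H \<in> \<H> \<Longrightarrow> E \<in> \<G> \<Longrightarrow> finite (H \<inter> E)" and rkd: "ranked \<H> rk"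
    using adm by (auto simp: admissible_def)
  have inf_A: "infinite A" using unc countable_finite by blast
  define \<S> where "\<S> = {E\<in>\<G>. |E| <o |A| }"
  define \<K> where "\<K> = {E\<in>\<G>. \<not> |E| <o |A| }"
  have sub_\<G>: "\<S> \<subseteq> \<G>" "\<K> \<subseteq> \<G>" and \<G>_eq: "\<G> = \<S> \<union> \<K>" by (auto simp: \<S>_def \<K>_def)
  have K_iso: "|K| =o |A|" if "K \<in> \<K>" for K
  proof -
    have "K \<subseteq> A" using that sub by (auto simp: \<K>_def)
    then have "|K| \<le>o |A|" by (rule card_of_mono1)
    then show ?thesis using that ordLeq_iff_ordLess_or_ordIso by (auto simp: \<K>_def)
  qed
  have inf_K: "infinite K" if "K \<in> \<K>" for K
    using K_iso[OF that] inf_A card_of_ordIso_finite by blast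

  \<comment> \<open>There are at most \<open>|A|\<close> edges of full size, each being determined
    by \<open>r\<close> points, so they can be indexed by an initial copy of \<open>A\<close>. With
    \<open>g K\<close> as rank of \<open>K\<close>, a small loss of \<open>K\<close> is smaller than
    \<open>K\<close>.\<close>
  obtain g where g_inj: "inj_on g \<K>" and g_under: "\<And>K. K \<in> \<K> \<Longrightarrow> |{..<g K}| <o |A|"
  proof -
    obtain \<phi> where \<phi>: "inj_on \<phi> {E\<in>\<G>. infinite E}" "\<phi> ` {E\<in>\<G>. infinite E} \<subseteq> {F. finite F \<and> F \<subseteq> A}"
      using inj_finite_subsets[OF ad sub] .
    have "\<K> \<subseteq> {E\<in>\<G>. infinite E}" using inf_K sub_\<G> by blast
    then have "|\<K>| \<le>o |{E\<in>\<G>. infinite E}|" by (rule card_of_mono1)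
    also have "|{E\<in>\<G>. infinite E}| \<le>o |{F. finite F \<and> F \<subseteq> A}|" using \<phi> card_of_ordLeq by blast
    also have "|{F. finite F \<and> F \<subseteq> A}| \<le>o |A|" by (rule card_of_finite_subsets[OF inf_A])
    finally have "|\<K>| \<le>o |A|" .
    then obtain g0 where g0: "inj_on g0 \<K>" "g0 ` \<K> \<subseteq> A" using card_of_ordLeq[of \<K> A] by blast
    obtain f where f: "inj_on f A" and "\<And>j i. j \<in> f ` A \<Longrightarrow> i < j \<Longrightarrow> i \<in> f ` A"
      and f_under: "\<And>j. j \<in> f ` A \<Longrightarrow> |{..<j}| <o |A|"
      using initial_copy[of A] by blast
    have "inj_on (f \<circ> g0) \<K>" using g0 f by (meson comp_inj_on inj_on_subset)
    moreover have "|{..<(f \<circ> g0) K}| <o |A|" if "K \<in> \<K>" for K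
      by (rule f_under) (use that g0(2) in auto)
    ultimately show thesis using that by blast
  qed

  define \<H>' where "\<H>' = \<H> \<union> \<K>"
  define rk' where "rk' H = (if H \<in> \<K> then g H else rk H)" for H
  have rkd': "ranked \<H>' rk'"
    unfolding ranked_def
  proof
    fix i
    have "inj_on g {K\<in>\<K>. g K \<le> i}" using g_inj by (rule inj_on_subset) blast
    moreover have "g ` {K\<in>\<K>. g K \<le> i} \<subseteq> {..i}" by auto
    ultimately have "|{K\<in>\<K>. g K \<le> i}| \<le>o |{..i}|" using card_of_ordLeq by blast
    moreover have "small i {..i}"
    proof -
      have "small i {..<i}" unfolding small_def by (simp add: ordLeq_reflexive[OF card_of_Well_order])
      then have "small i ({..<i} \<union> {i})" by (rule small_Un) (simp add: small_finite)
      then show ?thesis by (rule small_subset) (auto simp: le_less)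
    qed
    ultimately have "small i {K\<in>\<K>. g K \<le> i}" using small_ordLeq by blast
    moreover have "small i {H\<in>\<H>. rk H \<le> i}" using rkd unfolding ranked_def by blast
    ultimately have "small i ({K\<in>\<K>. g K \<le> i} \<union> {H\<in>\<H>. rk H \<le> i})" by (rule small_Un)
    then show "small i {H\<in>\<H>'. rk' H \<le> i}"
      by (rule small_subset) (auto simp: \<H>'_def rk'_def split: if_splits)
  qed
  have fin': "finite (H \<inter> E)" if "H \<in> \<H>'" "E \<in> \<G>" "H \<noteq> E" for H E
    using that fin almost_disjointD[OF ad, of H E] sub_\<G> unfolding \<H>'_def by blast
  have adm_\<S>: "admissible S r A \<S> \<H>' rk'"
  proof -
    have "finite (H \<inter> E)" if "H \<in> \<H>'" "E \<in> \<S>" for H E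
    proof (cases "H = E")
      case True
      then have "H \<in> \<H>" using that by (auto simp: \<H>'_def \<S>_def \<K>_def)
      then show ?thesis using fin that(2) sub_\<G> by blast
    next
      case False
      then show ?thesis using fin' that sub_\<G> by blast
    qed
    then show ?thesis
      using sub ne rkd' sub_\<G> sized_subset[OF sized sub_\<G>(1)] almost_disjoint_subset[OF ad sub_\<G>(1)]
      unfolding admissible_def by blast
  qed

  obtain C B where B_card: "\<And>c. c \<in> C \<Longrightarrow> |B c| <o |A|"
    and B_cover: "\<And>E. E \<in> \<G> \<Longrightarrow> |E| <o |A| \<Longrightarrow> \<exists>c\<in>C. E \<subseteq> B c"
    and B_trace: "\<And>c E. c \<in> C \<Longrightarrow> E \<in> \<G> \<Longrightarrow> E \<subseteq> B c \<Longrightarrow> (\<And>b. b \<in> C \<Longrightarrow> b < c \<Longrightarrow> \<not> E \<subseteq> B b) \<Longrightarrow>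
      E - (\<Union>b\<in>{b\<in>C. b < c}. B b) \<noteq> {} \<and>
      (finite E \<or> |E \<inter> (\<Union>b\<in>{b\<in>C. b < c}. B b)| <o |E| )"
    using filtration[OF ns cS unc sub ne sized ad] by blast

  \<comment> \<open>Block \<open>(0, c)\<close> holds the smaller edges whose first stage is
    \<open>c\<close>, block \<open>(1, i)\<close> at most one edge of full size. Blocks with a
    larger first component are empty.\<close>
  define U where "U x = (if fst x = (0 :: nat)
      then {E\<in>\<S>. snd x \<in> C \<and> E \<subseteq> B (snd x) \<and> (\<forall>b\<in>C. b < snd x \<longrightarrow> \<not> E \<subseteq> B b)}
      else {K\<in>\<K>. fst x = 1 \<and> g K = snd x})" for x
  define R where "R = less_than <*lex*> {(a, b :: 'a). a < b}"
  have R: "wf R" "trans R" "total R"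
  proof -
    show "wf R" unfolding R_def by (intro wf_lex_prod wf_less_than wf)
    show "trans R" unfolding R_def by (intro trans_lex_prod trans_less_than) (auto simp: trans_def)
    show "total R" unfolding R_def by (auto simp: total_on_def)
  qed
  define M where "M h x = (\<Union>y\<in>{y\<in>UNIV. (y, x) \<in> R}. h y)" for h :: "nat \<times> 'a \<Rightarrow> ('a \<times> 'a set) set" and x
  define P where "P h x N \<longleftrightarrow> extends \<H>' rk' (M h x) N \<and> snd ` N \<subseteq> U x \<and>
      (\<forall>E\<in>U x. E \<inter> pts (M h x \<union> N) \<noteq> {})" for h x N
  have "\<exists>N. \<forall>x. P N x (N x)"
  proof (rule dependent_wf_choice[OF R(1)])
    fix f f' :: "nat \<times> 'a \<Rightarrow> ('a \<times> 'a set) set" and x N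
    assume "\<And>z. (z, x) \<in> R \<Longrightarrow> f z = f' z"
    then have "M f x = M f' x" unfolding M_def by auto
    then show "P f x N = P f' x N" by (simp add: P_def)
  next
    fix x :: "nat \<times> 'a" and h
    assume prev: "\<And>y. (y, x) \<in> R \<Longrightarrow> P h y (h y)"
    let ?M = "M h x"
    show "\<exists>N. P h x N"
    proof (cases "fst x = 0")
      case True
      define c where "c = snd x"
      have x: "x = (0, c)" using True by (simp add: c_def prod_eq_iff)
      show ?thesis
      proof (cases "c \<in> C")
        case False
        then have "U x = {}" by (simp add: U_def x)
        then have "P h x {}" by (simp add: P_def extends_empty)
        then show ?thesis by blast
      next
        case c: True
        let ?D = "\<Union>b\<in>{b\<in>C. b < c}. B b"
        \<comment> \<open>Private edges chosen earlier lie in their own stages, so the points they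
          use up are confined to the earlier stages. Hence the estimate for traces in the filtration
          also holds for \<open>cov ?M\<close>.\<close>
        have cov_M: "cov ?M \<subseteq> ?D"
        proof
          fix z assume "z \<in> cov ?M"
          then obtain y E where y: "(y, x) \<in> R" "E \<in> snd ` h y" "z \<in> E"
            unfolding M_def cov_def by blast
          then have "E \<in> U y" using prev[OF y(1)] unfolding P_def by blast
          moreover obtain b where b: "y = (0, b)" "b < c" using y(1) by (cases y) (auto simp: R_def x)
          ultimately have "b \<in> C" "E \<subseteq> B b" by (auto simp: U_def)
          then show "z \<in> ?D" using b(2) y(3) by blast
        qed
        let ?F = "{E\<in>U x. E \<inter> pts ?M = {}}"
        have "admissible S r (B c) (traces ?F (cov ?M)) {H\<in>\<H>'. H \<inter> pts ?M = {}} rk'"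
        proof (rule admissible_traces[OF adm_\<S>])
          show "?F \<subseteq> \<S>" by (auto simp: U_def x)
          show "{H\<in>\<H>'. H \<inter> pts ?M = {}} \<subseteq> \<H>'" by blast
          fix E assume "E \<in> ?F"
          then have E: "E \<in> \<G>" "E \<subseteq> B c" "\<And>b. b \<in> C \<Longrightarrow> b < c \<Longrightarrow> \<not> E \<subseteq> B b"
            using sub_\<G> by (auto simp: U_def x)
          have tr: "E - ?D \<noteq> {}" "finite E \<or> |E \<inter> ?D| <o |E|" using B_trace[OF c E] by blast+
          have "|E \<inter> cov ?M| \<le>o |E \<inter> ?D|" by (rule card_of_mono1) (use cov_M in blast)
          then have "finite E \<or> |E \<inter> cov ?M| <o |E|" using tr(2) ordLeq_ordLess_trans by blast
          moreover have "E - cov ?M \<noteq> {}" using tr(1) cov_M by blast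
          moreover have "E - cov ?M \<subseteq> B c" using E(2) by blast
          ultimately show "E - cov ?M \<subseteq> B c \<and> E - cov ?M \<noteq> {} \<and> (finite E \<or> |E \<inter> cov ?M| <o |E| )"
            by blast
        qed
        from IH[OF B_card[OF c] this]
        obtain N where N: "extends \<H>' rk' ?M N" "snd ` N \<subseteq> ?F" "\<forall>E\<in>?F. E \<inter> pts N \<noteq> {}"
          by (rule extends_block) auto
        have "E \<inter> pts (?M \<union> N) \<noteq> {}" if "E \<in> U x" for E
          using N(3) that by (cases "E \<inter> pts ?M = {}") auto
        then have "P h x N" using N(1,2) unfolding P_def by blast
        then show ?thesis by blast
      qed
    next
      case False
      show ?thesis
      proof (cases "\<exists>K\<in>U x. K \<inter> pts ?M = {}")
        case no: False
        then have "P h x {}" unfolding P_def by (simp add: extends_empty)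
        then show ?thesis by blast
      next
        case True
        then obtain K where K: "K \<in> U x" "K \<inter> pts ?M = {}" by blast
        have K': "K \<in> \<K>" "g K = snd x" using K(1) False by (auto simp: U_def)
        have "L = K" if "L \<in> U x" for L
          by (rule inj_onD[OF g_inj]) (use that K(1) False in \<open>simp_all add: U_def\<close>)
        then have U_eq: "U x = {K}" using K(1) by blast
        \<comment> \<open>The blocks before \<open>x\<close> form an assembly of their own. As
          \<open>K\<close> was one of its ranked sets and is still unhit, its loss so far is small
          for the rank \<open>g K\<close>.\<close>
        have "small (rk' K) (K \<inter> cov ?M)"
        proof -
          let ?I = "{y\<in>UNIV. (y, x) \<in> R}"
          have ext: "extends \<H>' rk' (\<Union>z\<in>{z\<in>?I. (z, y) \<in> R}. h z) (h y)" if y: "y \<in> ?I" for y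
          proof -
            have "{z\<in>?I. (z, y) \<in> R} = {z\<in>UNIV. (z, y) \<in> R}" using y R(2) by (auto dest: transD)
            then show ?thesis using prev[of y] y unfolding P_def M_def by simp
          qed
          have "total_on ?I R" using R(3) by (auto simp: total_on_def)
          from assembly(2)[OF R(1,2) this rkd' ext, of K] K(2) K'(1)
          show ?thesis by (simp add: M_def \<H>'_def)
        qed
        then have "|K \<inter> cov ?M| <o |A|"
          by (rule small_ordLess[OF _ inf_A]) (use g_under K'(1) in \<open>simp add: rk'_def\<close>)
        then have "|K \<inter> cov ?M| <o |K|"
          using K_iso[OF K'(1)] ordIso_symmetric ordLess_ordIso_trans by blast
        have neK: "K - cov ?M \<noteq> {}"
        proof
          assume "K - cov ?M = {}"
          then have "K \<inter> cov ?M = K" by blast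
          then show False using \<open>|K \<inter> cov ?M| <o |K|\<close> ordLess_irreflexive[of "|K|"] by simp
        qed
        have finK: "finite (H \<inter> K)" if "H \<in> \<H>'" "H \<noteq> K" for H
          using fin'[OF that(1) _ that(2)] K'(1) sub_\<G> by blast
        obtain v where v: "v \<in> K - cov ?M" "extends \<H>' rk' ?M {(v, K)}"
          using extends_single[OF K(2) neK finK] .
        have "P h x {(v, K)}" using v U_eq unfolding P_def by simp
        then show ?thesis by blast
      qed
    qed
  qed
  then obtain N where N: "\<forall>x. P N x (N x)" by blast
  define T where "T = (\<Union>x\<in>UNIV. N x)"
  have ext: "extends \<H>' rk' (\<Union>y\<in>{y\<in>UNIV. (y, x) \<in> R}. N y) (N x)" for x
    using N unfolding P_def M_def by blast
  note asm = assembly[OF R rkd' ext]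
  have "private_cover \<G> T"
    unfolding private_cover_def
  proof (intro conjI ballI)
    show "private_edges T" unfolding T_def by (rule asm(1))
    have "snd ` N x \<subseteq> \<G>" for x
    proof -
      have "snd ` N x \<subseteq> U x" using N unfolding P_def by blast
      also have "U x \<subseteq> \<G>" using sub_\<G> by (auto simp: U_def)
      finally show ?thesis .
    qed
    then show "snd ` T \<subseteq> \<G>" unfolding T_def by blast
    fix E assume E: "E \<in> \<G>"
    have "\<exists>x. E \<in> U x"
    proof (cases "E \<in> \<K>")
      case True
      then have "E \<in> U (1, g E)" by (simp add: U_def)
      then show ?thesis by blast
    next
      case False
      then have "E \<in> \<S>" using E \<G>_eq by blast
      then obtain c0 where c0: "c0 \<in> C \<and> E \<subseteq> B c0" using B_cover by (auto simp: \<S>_def)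
      define c where "c = (LEAST c. c \<in> C \<and> E \<subseteq> B c)"
      have "c \<in> C \<and> E \<subseteq> B c" unfolding c_def by (rule LeastI[of _ c0]) (rule c0)
      moreover have "\<forall>b\<in>C. b < c \<longrightarrow> \<not> E \<subseteq> B b" using not_less_Least unfolding c_def by blast
      ultimately have "E \<in> U (0, c)" using \<open>E \<in> \<S>\<close> by (simp add: U_def)
      then show ?thesis by blast
    qed
    then obtain x where "E \<in> U x" by blast
    then have "E \<inter> pts (M N x \<union> N x) \<noteq> {}" using N unfolding P_def by blast
    moreover have "pts (M N x \<union> N x) \<subseteq> pts T" unfolding M_def T_def by (auto simp: pts_def)
    ultimately show "E \<inter> pts T \<noteq> {}" by blast
  qed
  moreover have "small (rk H) (H \<inter> cov T)" if H: "H \<in> \<H>" "H \<inter> pts T = {}" for H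
  proof -
    \<comment> \<open>An unhit set is no edge, so its rank was not replaced by an index and the
      bound is the required one.\<close>
    have "H \<notin> \<G>" using H(2) \<open>private_cover \<G> T\<close> by (auto simp: private_cover_def)
    then have "H \<notin> \<K>" using sub_\<G> by blast
    then have "rk' H = rk H" by (simp add: rk'_def)
    moreover have "small (rk' H) (H \<inter> cov T)"
      using asm(2)[of H] H unfolding T_def \<H>'_def by simp
    ultimately show ?thesis by simp
  qed
  ultimately show ?thesis unfolding solvable_def by blast
qed

text \<open>Plain solvability is the statement that is carried along. The strong form needed for the
  blocks follows from it on the same vertex set, so that it is available for all sets smaller than
  \<open>A\<close>.\<close>

lemma admissible_solvable:
  fixes S :: "'b rel set" and A :: "'a set"
  assumes ns: "nowhere_stationary S" and cS: "cardinals S"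
  shows "admissible S r A \<G> \<H> rk \<Longrightarrow> solvable \<G> \<H> rk"
proof (induction "|A|" arbitrary: A \<G> \<H> rk rule: wf_induct_rule[OF wf_ordLess])
  case (1 A)
  show ?case
  proof (cases "countable A")
    case True
    then show ?thesis using solvable_countable[OF 1(2)] by blast
  next
    case False
    show ?thesis
    proof (rule solvable_uncountable[OF ns cS False 1(2)])
      fix B :: "'a set" and \<G>' \<H>' rk'
      assume B: "|B| <o |A|" and adm: "admissible S r B \<G>' \<H>' rk'"
      show "strongly_solvable \<G>' \<H>' rk'"
        using strongly_solvable_if_traces_solvable[OF adm] 1(1)[OF B] by blast
    qed
  qed
qed

text \<open>At the outermost level there are no ranked sets to protect; they arise only within the
  recursion, as edges waiting to be hit.\<close>

lemma exists_minimal_vertex_cover: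
  fixes S :: "'b rel set" and \<G> :: "'a set set"
  assumes "nowhere_stationary S" "cardinals S" "{} \<notin> \<G>" "sized S \<G>" "almost_disjoint r \<G>"
  shows "\<exists>Y. minimal_vertex_cover \<G> Y"
proof -
  have "admissible S r UNIV \<G> {} rk" for rk
    using assms by (simp add: admissible_def ranked_def small_finite)
  then show ?thesis
    using admissible_solvable[OF assms(1,2)] minimal_vertex_cover_if_private_cover
    unfolding solvable_def by blast
qed

end

theorem theorem1p1:
  fixes lam :: "'a rel" and r :: nat and S :: "'b rel set" and \<E> :: "'a set set"
  assumes "Card_order lam"
    and "cardinals S"
    and "nowhere_stationary S"
    and "hypergraph \<E>"
    and "\<E> \<subseteq> subsets_of_card (Field lam) S"
    and "property_C (natLeq_on 2) (natLeq_on r) \<E>"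
  shows "\<exists>Y. minimal_vertex_cover \<E> Y"
proof -
  define W where "W = |UNIV :: 'a set|"
  have W: "Well_order W" "Field W = UNIV"
    unfolding W_def by (rule card_of_Well_order, rule Field_card_of)
  \<comment> \<open>Ranks and stages are elements of the vertex type, so the order is supplied by a
    well-order of that whole type.\<close>
  interpret wellorder "\<lambda>x y. (x, y) \<in> W" "\<lambda>x y. (x, y) \<in> W \<and> x \<noteq> y"
  proof unfold_locales
    have refl: "refl W" and trans: "trans W" and anti: "antisym W" and total: "total W"
      and wf: "wf (W - Id)"
      using W by (auto simp: well_order_on_def linear_order_on_def partial_order_on_def preorder_on_def)
    show "((x, y) \<in> W \<and> x \<noteq> y) \<longleftrightarrow> (x, y) \<in> W \<and> (y, x) \<notin> W" for x y
      using refl anti by (auto dest: antisymD reflD)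
    show "(x, x) \<in> W" for x using refl by (rule reflD)
    show "(x, y) \<in> W \<Longrightarrow> (y, z) \<in> W \<Longrightarrow> (x, z) \<in> W" for x y z using trans by (rule transD)
    show "(x, y) \<in> W \<Longrightarrow> (y, x) \<in> W \<Longrightarrow> x = y" for x y using anti by (rule antisymD)
    show "(x, y) \<in> W \<or> (y, x) \<in> W" for x y
      using total refl by (cases "x = y") (auto simp: total_on_def dest: reflD)
    show "(\<And>x. (\<And>y. (y, x) \<in> W \<and> y \<noteq> x \<Longrightarrow> P y) \<Longrightarrow> P x) \<Longrightarrow> P a" for P a
      using wf_induct_rule[OF wf, of P a] by blast
  qed
  have "{} \<notin> \<E>" using assms(4) by (simp add: hypergraph_def)
  moreover have "sized S \<E>" using assms(5) by (auto simp: sized_def subsets_of_card_def)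
  moreover have "almost_disjoint r \<E>"
    using assms(6) unfolding property_C_2_iff almost_disjoint_def .
  ultimately show ?thesis using exists_minimal_vertex_cover[OF assms(3,2)] by blast
qed

end
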